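(* Let $n\ge 1$, let $\alpha\in[0,1)$, and let $g:\mathbb{R}\to\mathbb{R}$ be a Lipschitz continuous, $1$-periodic function with $g(v)\le 0$ for all $v$. For $\varepsilon>0$ let $u^\varepsilon$ be the solution to $$\begin{cases}\dfrac{\partial u^\varepsilon}{\partial t}-\varepsilon^\alpha\Delta u^\varepsilon+g\left(\dfrac{u^\varepsilon}{\varepsilon}\right)=0 & t>0,\ x\in\mathbb{R}^n,\\[1mm] u^\varepsilon(x,0)=u_0(x), & x\in\mathbb{R}^n.\end{cases}$$ Assume that there exists $p\in\mathbb{R}^n$ such that $v_0(x):=u_0(x)-p\cdot x$ satisfies $v_0\in L^\infty(\mathbb{R}^n)$. Define $$c(p)=\begin{cases}-\displaystyle\int_0^1 g(s)\,ds & \text{if } p\neq 0,\\[2mm] -\left(\displaystyle\int_0^1\frac{1}{g(s)}\,ds\right)^{-1} & \text{if } p=0 \text{ and } g<0,\\[2mm] 0 & \text{if } p=0 \text{ and } \max g=0.\end{cases}$$ Then, for all $x\in\mathbb{R}^n$ and $t>0$, $$p\cdot x+c(p)t+\inf v_0\ \le\ \liminf_{\varepsilon\to 0}u^\varepsilon(x,t)\ \le\ \limsup_{\varepsilon\to 0}u^\varepsilon(x,t)\ \le\ p\cdot x+c(p)t+\sup v_0 .$$ In particular, if $u_0(x)-p\cdot x\equiv k$ for some $k\in\mathbb{R}$, then $$\lim_{\varepsilon\to 0}u^\varepsilon(x,t)=p\cdot x+c(p)t+k\qquad\text{uniformly in } x\in\mathbb{R}^n,\ t\ge 0 .$$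
   Context: Here $\Delta$ is the Laplacian in the variable $x\in\mathbb{R}^n$. The unknown $u^\varepsilon=u^\varepsilon(x,t)$ is real-valued on $\mathbb{R}^n\times[0,\infty)$. Since $g$ is Lipschitz, the standard existence, uniqueness and comparison principle for the Cauchy problem are understood to hold.
   Formalization: For p ≠ 0 the final convergence is proved uniformly in x and in t on each bounded interval [0,T], not on all t ≥ 0, where it fails (e.g. n=1, p=1, α=0, g(v) = −2 − cos 2πv); for p = 0 it is uniform for all t ≥ 0. *)

theory Defs
  imports "HOL-Analysis.Analysis" "HOL-Probability.Essential_Supremum"
begin

definition partial :: "'n \<Rightarrow> (real ^ 'n \<Rightarrow> real) \<Rightarrow> real ^ 'n \<Rightarrow> real" where
  "partial i f x = deriv (\<lambda>s. f (x + s *\<^sub>R axis i 1)) 0"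

definition has_partial :: "'n \<Rightarrow> (real ^ 'n \<Rightarrow> real) \<Rightarrow> real ^ 'n \<Rightarrow> bool" where
  "has_partial i f x \<longleftrightarrow> (\<lambda>s. f (x + s *\<^sub>R axis i 1)) differentiable (at 0)"

definition laplacian :: "(real ^ 'n \<Rightarrow> real) \<Rightarrow> real ^ 'n \<Rightarrow> real" where
  "laplacian f x = (\<Sum>i\<in>UNIV. partial i (partial i f) x)"

definition C21 :: "(real ^ 'n \<Rightarrow> real \<Rightarrow> real) \<Rightarrow> bool" where
  "C21 u \<longleftrightarrow>
     (\<forall>x. \<forall>t>0. u x differentiable (at t) \<and>
        (\<forall>i. has_partial i (\<lambda>y. u y t) x \<and>
          (\<forall>j. has_partial j (partial i (\<lambda>y. u y t)) x))) \<and>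
     continuous_on (UNIV \<times> {0<..}) (\<lambda>(x, t). u x t) \<and>
     continuous_on (UNIV \<times> {0<..}) (\<lambda>(x, t). deriv (u x) t) \<and>
     (\<forall>i. continuous_on (UNIV \<times> {0<..}) (\<lambda>(x, t). partial i (\<lambda>y. u y t) x)) \<and>
     (\<forall>i j. continuous_on (UNIV \<times> {0<..})
        (\<lambda>(x, t). partial j (partial i (\<lambda>y. u y t)) x))"

text \<open>
  The solution of the Cauchy problem: classical for positive times, as parabolic regularity
  gives for Lipschitz g. The initial datum is only a bounded measurable perturbation of a
  linear function, so a solution need not be continuous up to t = 0, and the initial values
  are attained as limits at almost every point. Without a growth condition at spatial infinity
  uniqueness and comparison fail (Tychonoff), already for the heat equation; linear growth,
  locally uniformly in time, is the growth of the data considered here.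
\<close>

definition cauchy_solution ::
  "real \<Rightarrow> real \<Rightarrow> (real \<Rightarrow> real) \<Rightarrow> (real ^ 'n \<Rightarrow> real) \<Rightarrow> (real ^ 'n \<Rightarrow> real \<Rightarrow> real) \<Rightarrow> bool" where
  "cauchy_solution \<alpha> \<epsilon> g u\<^sub>0 u \<longleftrightarrow>
     C21 u \<and>
     (\<forall>x. \<forall>t>0. deriv (u x) t - \<epsilon> powr \<alpha> * laplacian (\<lambda>y. u y t) x + g (u x t / \<epsilon>) = 0) \<and>
     (\<forall>x. u x 0 = u\<^sub>0 x) \<and>
     (AE x in lebesgue. (u x \<longlongrightarrow> u\<^sub>0 x) (at_right 0)) \<and>
     (\<forall>T>0. \<exists>C. \<forall>x. \<forall>t\<in>{0<..T}. \<bar>u x t\<bar> \<le> C * (1 + norm x))"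

definition in_Linfty :: "(real ^ 'n \<Rightarrow> real) \<Rightarrow> bool" where
  "in_Linfty v \<longleftrightarrow> v \<in> borel_measurable lebesgue \<and> (\<exists>M. AE x in lebesgue. \<bar>v x\<bar> \<le> M)"

text \<open>
  Bounds of an element of L-infinity are essential bounds; they are at least as sharp
  as the pointwise supremum and infimum.
\<close>

definition ess_sup :: "(real ^ 'n \<Rightarrow> real) \<Rightarrow> ereal" where
  "ess_sup v = esssup lebesgue (\<lambda>x. ereal (v x))"

definition ess_inf :: "(real ^ 'n \<Rightarrow> real) \<Rightarrow> ereal" where
  "ess_inf v = - esssup lebesgue (\<lambda>x. - ereal (v x))"

text \<open>
  For continuous periodic g with values in the nonpositive reals, the last case is
  exactly p = 0 and max g = 0.
\<close>

definition speed :: "(real \<Rightarrow> real) \<Rightarrow> real ^ 'n \<Rightarrow> real" where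
  "speed g p =
     (if p \<noteq> 0 then - integral {0..1} g
      else if \<forall>s. g s < 0 then - inverse (integral {0..1} (\<lambda>s. 1 / g s))
      else 0)"

end

theory Submission
  imports Defs
begin

text \<open>
  For \<open>p \<noteq> 0\<close> the solution is trapped between the waves \<open>z + \<epsilon> \<eta> w(z / \<epsilon>)\<close>, where
  \<open>z = p \<bullet> x + (c \<plusminus> A \<eta>) t + const\<close>, \<open>\<eta> = \<epsilon> powr (1 - \<alpha>)\<close>, \<open>c = speed g p\<close> and \<open>w\<close> is the
  periodic corrector with \<open>(norm p)\<^sup>2 w'' = g + c\<close>: since \<open>\<alpha> < 1\<close>, diffusion dominates at scale
  \<open>\<epsilon>\<close>, so \<open>g\<close> is simply averaged, and the remaining error of order \<open>\<eta>\<close> in the equation is absorbed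
  by the correction \<open>\<plusminus> A \<eta>\<close> of the speed. For \<open>p = 0\<close> the barriers do not depend on \<open>x\<close>: they solve
  the ordinary differential equation, whose time change \<open>F\<close> with \<open>F' = -1/g\<close> is linear up to a
  periodic function, or are constants when \<open>g\<close> vanishes somewhere.

  Comparison with initial data attained only almost everywhere follows from an integral maximum
  principle: the space integral of the cubed positive part of a subsolution, if compactly
  supported, decreases in time.
\<close>

subsection \<open>Maximum and comparison principles\<close>

text \<open>The derivatives are carried as explicit functions, so that differences, scalings and
  barriers are handled by derivative rules. Only \<open>t > 0\<close> is covered, where a solution
  is classical, and \<open>D2 i\<close> is the pure second derivative in direction \<open>i\<close>,
  all that the Laplacian needs.\<close>

definition parabolic_derivs ::
  "(real ^ 'n \<Rightarrow> real \<Rightarrow> real) \<Rightarrow> (real ^ 'n \<Rightarrow> real \<Rightarrow> real) \<Rightarrow>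
   ('n \<Rightarrow> real ^ 'n \<Rightarrow> real \<Rightarrow> real) \<Rightarrow> ('n \<Rightarrow> real ^ 'n \<Rightarrow> real \<Rightarrow> real) \<Rightarrow> bool" where
  "parabolic_derivs w wt D D2 \<longleftrightarrow>
     (\<forall>x. \<forall>t>0. (w x has_real_derivative wt x t) (at t) \<and>
        (\<forall>i. ((\<lambda>s. w (x + s *\<^sub>R axis i 1) t) has_real_derivative D i x t) (at 0) \<and>
             ((\<lambda>s. D i (x + s *\<^sub>R axis i 1) t) has_real_derivative D2 i x t) (at 0))) \<and>
     continuous_on (UNIV \<times> {0<..}) (\<lambda>(x, t). w x t) \<and>
     continuous_on (UNIV \<times> {0<..}) (\<lambda>(x, t). wt x t) \<and>
     (\<forall>i. continuous_on (UNIV \<times> {0<..}) (\<lambda>(x, t). D i x t)) \<and>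
     (\<forall>i. continuous_on (UNIV \<times> {0<..}) (\<lambda>(x, t). D2 i x t))"

section \<open>Integration by parts with the positive part\<close>

lemma continuous_on_spatial_slice:
  fixes f :: "'a::topological_space \<Rightarrow> real \<Rightarrow> real"
  assumes "continuous_on (UNIV \<times> {0<..}) (\<lambda>(x, t). f x t)" "0 < t"
  shows "continuous_on S (\<lambda>x. f x t)"
proof -
  have "continuous_on S (\<lambda>x. (\<lambda>(x, t). f x t) (x, t))"
    by (rule continuous_on_compose2[OF assms(1)]) (use assms(2) in \<open>auto intro!: continuous_intros\<close>)
  then show ?thesis by simp
qed

text \<open>Translating \<open>f\<close> along \<open>e\<close> by less than 1 does not change its
  integral over a box that contains the support with margin 1; differentiating under the integral
  sign at \<open>s = 0\<close> gives the claim. It serves as integration by parts below.\<close>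

lemma integral_directional_derivative_eq_0:
  fixes f f' :: "'a::euclidean_space \<Rightarrow> real"
  assumes der: "\<And>x. ((\<lambda>s. f (x + s *\<^sub>R e)) has_real_derivative f' x) (at 0)"
    and contf: "continuous_on UNIV f" and contf': "continuous_on UNIV f'"
    and supp: "\<And>x. R \<le> norm x \<Longrightarrow> f x = 0"
    and e: "norm e \<le> 1" and box: "ball 0 (R + 1) \<subseteq> cbox c d"
  shows "integral (cbox c d) f' = 0"
proof -
  define \<Psi> where "\<Psi> s = integral (cbox c d) (\<lambda>x. f (x + s *\<^sub>R e))" for s
  \<comment> \<open>The derivative is assumed only at parameter 0; moving the base point along the
    line gives it at every \<open>s\<close>, as the Leibniz rule requires.\<close>
  have der': "((\<lambda>s. f (x + s *\<^sub>R e)) has_real_derivative f' (x + s *\<^sub>R e)) (at s)" for x s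
  proof -
    have "((\<lambda>r. f ((x + s *\<^sub>R e) + (r - s) *\<^sub>R e)) has_real_derivative f' (x + s *\<^sub>R e)) (at s)"
      using DERIV_shift[of "\<lambda>r. f ((x + s *\<^sub>R e) + r *\<^sub>R e)" _ s "- s"] der[of "x + s *\<^sub>R e"] by simp
    then show ?thesis by (simp add: algebra_simps)
  qed
  have "(\<Psi> has_real_derivative integral (cbox c d) (\<lambda>x. f' (x + 0 *\<^sub>R e))) (at 0 within UNIV)"
    unfolding \<Psi>_def
  proof (rule leibniz_rule_field_derivative)
    show "((\<lambda>s. f (x + s *\<^sub>R e)) has_real_derivative f' (x + s *\<^sub>R e)) (at s within UNIV)" for x s
      using der' by simp
    show "(\<lambda>x. f (x + s *\<^sub>R e)) integrable_on cbox c d" for s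
      by (intro integrable_continuous continuous_on_compose2[OF contf] continuous_intros) auto
    show "continuous_on (UNIV \<times> cbox c d) (\<lambda>(s, x). f' (x + s *\<^sub>R e))"
      unfolding case_prod_beta
      by (intro continuous_on_compose2[OF contf'] continuous_intros) auto
  qed auto
  then have 1: "(\<Psi> has_real_derivative integral (cbox c d) f') (at 0)" by simp
  \<comment> \<open>The shift is moved from the integrand to the box. Its length is at most 1, so
    the shifted box still contains the support and the integral is the one over the whole
    space.\<close>
  have const: "\<Psi> s = integral UNIV f" if "\<bar>s\<bar> < 1" for s
  proof -
    have se: "norm (s *\<^sub>R e) \<le> 1" using that e
      by (simp add: mult_le_one)
    have "\<Psi> s = integral (cbox (c + s *\<^sub>R e) (d + s *\<^sub>R e)) f"
      using integral_shift_cbox_plus[of c d f "s *\<^sub>R e"]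
      by (simp add: \<Psi>_def o_def add.commute)
    also have "\<dots> = integral UNIV f"
    proof -
      have "x \<in> cbox (c + s *\<^sub>R e) (d + s *\<^sub>R e)" if "f x \<noteq> 0" for x
      proof -
        have "norm x < R" using that supp[of x] by (rule_tac ccontr) auto
        then have "x - s *\<^sub>R e \<in> ball 0 (R + 1)"
          using norm_triangle_ineq4[of x "s *\<^sub>R e"] se by simp
        then show ?thesis using box by (auto simp: mem_box algebra_simps subset_iff)
      qed
      then have "(\<lambda>x. if x \<in> cbox (c + s *\<^sub>R e) (d + s *\<^sub>R e) then f x else 0) = f"
        by (auto simp: fun_eq_iff)
      then show ?thesis
        using integral_restrict_UNIV[of "cbox (c + s *\<^sub>R e) (d + s *\<^sub>R e)" f] by simp
    qed
    finally show ?thesis .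
  qed
  have "(\<Psi> has_real_derivative 0) (at 0)"
    by (rule has_field_derivative_transform_within_open[where S="{-1<..<1}" and f="\<lambda>_. integral UNIV f"])
      (auto simp: const)
  with 1 show ?thesis by (rule DERIV_unique)
qed

lemma parabolic_derivsD:
  assumes "parabolic_derivs w wt D D2"
  shows "0 < t \<Longrightarrow> (w x has_real_derivative wt x t) (at t)"
    and "0 < t \<Longrightarrow> ((\<lambda>s. w (x + s *\<^sub>R axis i 1) t) has_real_derivative D i x t) (at 0)"
    and "0 < t \<Longrightarrow> ((\<lambda>s. D i (x + s *\<^sub>R axis i 1) t) has_real_derivative D2 i x t) (at 0)"
    and "continuous_on (UNIV \<times> {0<..}) (\<lambda>(x, t). w x t)"
    and "continuous_on (UNIV \<times> {0<..}) (\<lambda>(x, t). wt x t)"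
    and "continuous_on (UNIV \<times> {0<..}) (\<lambda>(x, t). D i x t)"
    and "continuous_on (UNIV \<times> {0<..}) (\<lambda>(x, t). D2 i x t)"
  using assms by (auto simp: parabolic_derivs_def)

text \<open>For \<open>0 < n\<close> the exponent is at least 2, which smooths the corner at 0 to
  first order. The square and the cube are used below.\<close>

lemma has_real_derivative_pos_part_power:
  assumes "0 < n"
  shows "((\<lambda>s::real. max 0 s ^ Suc n) has_real_derivative real (Suc n) * max 0 s ^ n) (at s)"
proof -
  consider "s < 0" | "s = 0" | "s > 0" by linarith
  then show ?thesis
  proof cases
    case 1
    have "((\<lambda>s::real. max 0 s ^ Suc n) has_real_derivative 0) (at s)"
      by (rule has_field_derivative_transform_within_open[where S="{..<0}" and f="\<lambda>_. 0"]) (use 1 in auto)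
    then show ?thesis using 1 assms by (simp add: power_0_left)
  next
    case 2
    have "((\<lambda>h::real. max 0 h ^ n) \<longlongrightarrow> max 0 0 ^ n) (at 0)"
      by (intro tendsto_intros)
    moreover have "max 0 0 ^ n = (0::real)" using assms by (simp add: power_0_left)
    ultimately have "((\<lambda>h::real. max 0 h ^ n) \<longlongrightarrow> 0) (at 0)" by (simp only:)
    \<comment> \<open>The difference quotient is \<open>h ^ n\<close> for \<open>h > 0\<close> and 0
      for \<open>h < 0\<close>.\<close>
    moreover have "\<forall>\<^sub>F h in at (0::real). max 0 h ^ n = (max 0 (0 + h) ^ Suc n - max 0 0 ^ Suc n) / h"
      unfolding eventually_at using assms by (intro exI[of _ 1]) (auto simp: max_def)
    ultimately have "((\<lambda>h::real. (max 0 (0 + h) ^ Suc n - max 0 0 ^ Suc n) / h) \<longlongrightarrow> 0) (at 0)"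
      by (rule Lim_transform_eventually)
    then show ?thesis using 2 assms by (simp add: DERIV_def power_0_left)
  next
    case 3
    have "((\<lambda>s::real. s ^ Suc n) has_real_derivative real (Suc n) * s ^ n) (at s)"
      using DERIV_pow[of "Suc n" s] by simp
    then have "((\<lambda>s::real. max 0 s ^ Suc n) has_real_derivative real (Suc n) * s ^ n) (at s)"
      by (rule has_field_derivative_transform_within_open[where S="{0<..}"]) (use 3 in auto)
    then show ?thesis using 3 by simp
  qed
qed

text \<open>The derivative of \<open>(max 0 y)\<^sup>2 * D i\<close> in direction \<open>i\<close>
  integrates to 0. By the product rule it is the integrand here plus
  \<open>2 * max 0 y * (D i)\<^sup>2\<close>, which is nonnegative. The square is what makes the
  truncation continuously differentiable.\<close>

lemma integral_pos_part_sq_second_partial_nonpos: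
  fixes y :: "real ^ 'n \<Rightarrow> real \<Rightarrow> real"
  assumes P: "parabolic_derivs y yt D D2" and t: "0 < t"
    and supp: "\<And>x. R \<le> norm x \<Longrightarrow> y x t \<le> 0"
    and box: "ball 0 (R + 1) \<subseteq> cbox c d"
  shows "integral (cbox c d) (\<lambda>x. (max 0 (y x t))\<^sup>2 * D2 i x t) \<le> 0"
proof -
  note [continuous_intros] =
    continuous_on_spatial_slice[OF parabolic_derivsD(4)[OF P] t]
    continuous_on_spatial_slice[OF parabolic_derivsD(6)[OF P] t]
    continuous_on_spatial_slice[OF parabolic_derivsD(7)[OF P] t]
  let ?A = "\<lambda>x. 2 * max 0 (y x t) * (D i x t)\<^sup>2" and ?B = "\<lambda>x. (max 0 (y x t))\<^sup>2 * D2 i x t"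
  have "integral (cbox c d) (\<lambda>x. ?A x + ?B x) = 0"
  proof (rule integral_directional_derivative_eq_0[where e="axis i 1" and R=R and f="\<lambda>x. (max 0 (y x t))\<^sup>2 * D i x t"])
    fix x
    have 1: "((\<lambda>s. (max 0 (y (x + s *\<^sub>R axis i 1) t))\<^sup>2) has_real_derivative (2 * max 0 (y x t)) * D i x t) (at 0)"
      using DERIV_chain2[OF has_real_derivative_pos_part_power[of 1] parabolic_derivsD(2)[OF P t, of x i]]
      by (simp add: numeral_2_eq_2)
    show "((\<lambda>s. (max 0 (y (x + s *\<^sub>R axis i 1) t))\<^sup>2 * D i (x + s *\<^sub>R axis i 1) t) has_real_derivative ?A x + ?B x) (at 0)"
      using DERIV_mult[OF 1 parabolic_derivsD(3)[OF P t, of i x]]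
      by (simp add: power2_eq_square algebra_simps)
  next
    show "continuous_on UNIV (\<lambda>x. (max 0 (y x t))\<^sup>2 * D i x t)"
      "continuous_on UNIV (\<lambda>x. ?A x + ?B x)"
      by (intro continuous_intros)+
    show "(max 0 (y x t))\<^sup>2 * D i x t = 0" if "R \<le> norm x" for x
      using supp[OF that] by simp
  qed (use box in \<open>auto simp: norm_axis_1\<close>)
  moreover have "integral (cbox c d) (\<lambda>x. ?A x + ?B x) = integral (cbox c d) ?A + integral (cbox c d) ?B"
    by (rule integral_add; intro integrable_continuous continuous_intros)
  moreover have "integral (cbox c d) ?A \<ge> 0"
    by (rule integral_nonneg) (auto intro!: integrable_continuous continuous_intros)
  ultimately show ?thesis by simp
qed

text \<open>The integral \<open>\<Phi>\<close> of the cubed positive part has derivative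
  \<open>3 * (max 0 y)\<^sup>2 * yt\<close> integrated over space, which the subsolution inequality
  and the previous lemma bound by 0. Dominated convergence, with the bound \<open>M\<close>, sends
  \<open>\<Phi>\<close> to 0 as time decreases to 0, so the initial condition is used only almost
  everywhere.\<close>

lemma maximum_principle_compact:
  fixes y :: "real ^ 'n \<Rightarrow> real \<Rightarrow> real"
  assumes P: "parabolic_derivs y yt D D2" and a: "0 \<le> a"
    and sub: "\<And>x t. 0 < t \<Longrightarrow> t \<le> T \<Longrightarrow> 0 < y x t \<Longrightarrow> yt x t \<le> a * (\<Sum>i\<in>UNIV. D2 i x t)"
    and supp: "\<And>x t. 0 < t \<Longrightarrow> t \<le> T \<Longrightarrow> R \<le> norm x \<Longrightarrow> y x t \<le> 0"
    and bound: "\<And>x t. 0 < t \<Longrightarrow> t \<le> T \<Longrightarrow> y x t \<le> M"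
    and init: "AE x in lebesgue. \<exists>l\<le>0. (y x \<longlongrightarrow> l) (at_right 0)"
    and t: "0 < t" "t \<le> T"
  shows "y x t \<le> 0"
proof -
  \<comment> \<open>The box has to contain the support with margin 1 and also the point
    \<open>x\<close> at which the conclusion is read off.\<close>
  obtain b where box: "ball 0 (max R (norm x) + 1) \<subseteq> cbox (-b) (b::real^'n)"
    using bounded_subset_cbox_symmetric[OF bounded_ball] by metis
  let ?Q = "cbox (-b) b"
  have box': "ball 0 (R + 1) \<subseteq> ?Q" using box by (force simp: subset_iff)
  define h where "h x t = max 0 (y x t) ^ 3" for x t
  define \<Phi> where "\<Phi> t = integral ?Q (\<lambda>x. h x t)" for t
  have hc: "continuous_on S (\<lambda>x. h x t)" if "0 < t" for t S
    unfolding h_def by (intro continuous_intros continuous_on_spatial_slice[OF parabolic_derivsD(4)[OF P] that])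
  have h0: "0 \<le> h x t" for x t by (simp add: h_def)
  have d\<Phi>: "(\<Phi> has_real_derivative integral ?Q (\<lambda>x. 3 * (max 0 (y x t))\<^sup>2 * yt x t)) (at t)" if t: "0 < t" for t
  proof -
    have "((\<lambda>t. integral ?Q (\<lambda>x. h x t)) has_real_derivative integral ?Q (\<lambda>x. 3 * (max 0 (y x t))\<^sup>2 * yt x t)) (at t within {0<..})"
    proof (rule leibniz_rule_field_derivative)
      show "((\<lambda>t. h x t) has_real_derivative 3 * (max 0 (y x t))\<^sup>2 * yt x t) (at t within {0<..})"
        if "t \<in> {0<..}" for x t
        using DERIV_chain2[OF has_real_derivative_pos_part_power[of 2] parabolic_derivsD(1)[OF P, of t x]] that
        by (auto simp: h_def eval_nat_numeral has_field_derivative_at_within)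
      show "(\<lambda>x. h x t) integrable_on ?Q" if "t \<in> {0<..}" for t
        using that by (intro integrable_continuous hc) auto
      have "continuous_on ({0<..} \<times> ?Q) (\<lambda>z. (\<lambda>(x, t). y x t) (snd z, fst z))"
        by (intro continuous_on_compose2[OF parabolic_derivsD(4)[OF P]] continuous_intros) auto
      moreover have "continuous_on ({0<..} \<times> ?Q) (\<lambda>z. (\<lambda>(x, t). yt x t) (snd z, fst z))"
        by (intro continuous_on_compose2[OF parabolic_derivsD(5)[OF P]] continuous_intros) auto
      ultimately show "continuous_on ({0<..} \<times> ?Q) (\<lambda>(t, x). 3 * (max 0 (y x t))\<^sup>2 * yt x t)"
        unfolding case_prod_beta by (auto intro!: continuous_intros)
    qed (use t in auto)
    then show ?thesis
      using t by (simp add: at_within_open[of t "{0<..}"] \<Phi>_def[abs_def])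
  qed
  have d\<Phi>_le: "integral ?Q (\<lambda>x. 3 * (max 0 (y x t))\<^sup>2 * yt x t) \<le> 0" if t: "0 < t" "t \<le> T" for t
  proof -
    note [continuous_intros] =
      continuous_on_spatial_slice[OF parabolic_derivsD(4)[OF P] t(1)]
      continuous_on_spatial_slice[OF parabolic_derivsD(5)[OF P] t(1)]
      continuous_on_spatial_slice[OF parabolic_derivsD(7)[OF P] t(1)]
    have "integral ?Q (\<lambda>x. 3 * (max 0 (y x t))\<^sup>2 * yt x t)
        \<le> integral ?Q (\<lambda>x. \<Sum>i\<in>UNIV. (3 * a) * ((max 0 (y x t))\<^sup>2 * D2 i x t))"
    proof (rule integral_le)
      fix x
      show "3 * (max 0 (y x t))\<^sup>2 * yt x t \<le> (\<Sum>i\<in>UNIV. (3 * a) * ((max 0 (y x t))\<^sup>2 * D2 i x t))"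
      \<comment> \<open>Where \<open>y\<close> is not positive the weight vanishes and both sides
        are 0, so the differential inequality is needed only where \<open>y\<close> is
        positive.\<close>
      proof (cases "0 < y x t")
        case True
        have "3 * (max 0 (y x t))\<^sup>2 * yt x t \<le> 3 * (max 0 (y x t))\<^sup>2 * (a * (\<Sum>i\<in>UNIV. D2 i x t))"
          using sub[OF t True] by (intro mult_left_mono) auto
        also have "\<dots> = (\<Sum>i\<in>UNIV. (3 * a) * ((max 0 (y x t))\<^sup>2 * D2 i x t))"
          by (simp add: sum_distrib_left sum_distrib_right mult_ac)
        finally show ?thesis .
      qed simp
    qed (auto intro!: integrable_continuous continuous_intros)
    also have "\<dots> = (\<Sum>i\<in>UNIV. (3 * a) * integral ?Q (\<lambda>x. (max 0 (y x t))\<^sup>2 * D2 i x t))"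
      by (subst integral_sum) (auto intro!: integrable_continuous continuous_intros)
    also have "\<dots> \<le> 0"
      using integral_pos_part_sq_second_partial_nonpos[OF P t(1) supp[OF t] box'] a
      by (intro sum_nonpos mult_nonneg_nonpos) auto
    finally show ?thesis .
  qed
  have mono: "\<Phi> t \<le> \<Phi> s" if "0 < s" "s \<le> t" "t \<le> T" for s t
  proof (rule DERIV_nonpos_imp_nonincreasing[OF that(2)])
    fix \<tau> assume "s \<le> \<tau>" "\<tau> \<le> t"
    then have "0 < \<tau>" "\<tau> \<le> T" using that by auto
    then show "\<exists>y. (\<Phi> has_real_derivative y) (at \<tau>) \<and> y \<le> 0"
      using d\<Phi> d\<Phi>_le by blast
  qed
  \<comment> \<open>Time 0 is approached along a sequence; the offset by 1 keeps every term,
    including the first, in the interval from 0 to \<open>T\<close>.\<close>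
  have lim: "(\<lambda>k. \<Phi> (T / (real k + 1))) \<longlonglongrightarrow> 0"
  proof -
    from init obtain N where N: "N \<in> null_sets lebesgue"
      and lim: "\<And>x. x \<notin> N \<Longrightarrow> \<exists>l\<le>0. (y x \<longlongrightarrow> l) (at_right 0)"
      by (auto elim!: AE_E3)
    have neg: "negligible N" using N by (simp add: negligible_iff_null_sets)
    \<comment> \<open>Setting the integrand to 0 on the exceptional null set gives convergence at
      every point and leaves the integrals unchanged.\<close>
    define f where "f k x = (if x \<in> N then 0 else h x (T / (real k + 1)))" for k x
    have pos: "0 < T / (real k + 1)" "T / (real k + 1) \<le> T" for k :: nat
      using t by (auto simp: field_simps mult_le_cancel_left1)
    have eq: "integral ?Q (f k) = \<Phi> (T / (real k + 1))" for k :: nat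
      unfolding \<Phi>_def by (rule integral_spike[OF neg]) (simp add: f_def add.commute)
    have "(\<lambda>k. integral ?Q (f k)) \<longlonglongrightarrow> integral ?Q (\<lambda>x. 0)"
    proof (rule dominated_convergence(2))
      show "f k integrable_on ?Q" for k
        by (rule integrable_spike[OF integrable_continuous[OF hc[OF pos(1)[of k]]] neg]) (simp add: f_def)
      show "(\<lambda>x. max 0 M ^ 3) integrable_on ?Q" by (rule integrable_const)
      show "norm (f k x) \<le> max 0 M ^ 3" for k x
        using bound[OF pos[of k], of x] h0 by (auto simp: f_def h_def intro!: power_mono)
      show "(\<lambda>k. f k x) \<longlonglongrightarrow> 0" for x
      proof (cases "x \<in> N")
        case False
        then obtain l where l: "l \<le> 0" "(y x \<longlongrightarrow> l) (at_right 0)" using lim by blast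
        have "filterlim (\<lambda>k. T / (real k + 1)) (at_right 0) sequentially"
          unfolding filterlim_at
        proof
          show "(\<lambda>k. T / (real k + 1)) \<longlonglongrightarrow> 0"
            using LIMSEQ_Suc[OF lim_const_over_n[of T]] by (simp add: add.commute)
        qed (use pos in auto)
        from filterlim_compose[OF l(2) this]
        have "(\<lambda>k. max 0 (y x (T / (real k + 1))) ^ 3) \<longlonglongrightarrow> max 0 l ^ 3"
          by (intro tendsto_intros)
        then show ?thesis using l(1) False by (simp add: f_def h_def)
      qed (simp add: f_def)
    qed
    then show ?thesis by (simp add: eq add.commute)
  qed
  have "\<Phi> t \<le> 0"
  proof (rule LIMSEQ_le_const[OF lim])
    have "\<forall>\<^sub>F k::nat in sequentially. T / (real k + 1) < t"
    proof -
      have "(\<lambda>k. T / (real k + 1)) \<longlonglongrightarrow> 0"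
        using LIMSEQ_Suc[OF lim_const_over_n[of T]] by (simp add: add.commute)
      then show ?thesis using t(1) by (rule order_tendstoD)
    qed
    then have "\<forall>\<^sub>F k::nat in sequentially. \<Phi> t \<le> \<Phi> (T / (real k + 1))"
    proof eventually_elim
      case (elim k)
      show ?case by (rule mono) (use elim t in \<open>auto intro: divide_pos_pos\<close>)
    qed
    then show "\<exists>N. \<forall>k\<ge>N. \<Phi> t \<le> \<Phi> (T / (real k + 1))"
      by (simp add: eventually_sequentially)
  qed
  moreover have "\<Phi> t \<ge> 0" unfolding \<Phi>_def
    by (rule integral_nonneg) (auto intro!: integrable_continuous hc h0 t)
  ultimately have "integral ?Q (\<lambda>x. h x t) = 0" by (simp add: \<Phi>_def)
  moreover have "x \<in> ?Q" using box by (auto simp: subset_iff)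
  \<comment> \<open>Nonempty interior is what lets a zero integral of a continuous nonnegative
    function force it to vanish on the whole closed box.\<close>
  moreover have "box (-b) b \<noteq> {}"
  proof -
    have "ball 0 (max R (norm x) + 1) \<subseteq> interior ?Q"
      by (rule interior_maximal[OF box open_ball])
    moreover have "0 \<in> ball (0::real^'n) (max R (norm x) + 1)" using norm_ge_zero[of x] by (simp add: max_def del: norm_ge_zero)
    ultimately show ?thesis by (metis empty_iff interior_cbox subset_iff)
  qed
  ultimately have "h x t = 0"
    using integral_cbox_eq_0_iff[of "-b" b "\<lambda>x. h x t"] hc[OF t(1)] h0 by blast
  then show ?thesis by (simp add: h_def max_def split: if_splits)
qed

section \<open>Maximum principle and comparison under linear growth\<close>

lemma parabolic_derivs_diff:
  assumes "parabolic_derivs u ut D D2" "parabolic_derivs v vt E E2"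
  shows "parabolic_derivs (\<lambda>x t. u x t - v x t) (\<lambda>x t. ut x t - vt x t)
           (\<lambda>i x t. D i x t - E i x t) (\<lambda>i x t. D2 i x t - E2 i x t)"
  using assms unfolding parabolic_derivs_def case_prod_beta
  by (auto intro!: derivative_intros continuous_on_diff)

text \<open>Applied with a negative rate, this absorbs the zeroth-order term \<open>k * w\<close>
  that \<open>maximum_principle\<close> allows.\<close>

lemma parabolic_derivs_exp_scale:
  assumes "parabolic_derivs w wt D D2"
  shows "parabolic_derivs (\<lambda>x t. exp (k * t) * w x t) (\<lambda>x t. exp (k * t) * (wt x t + k * w x t))
           (\<lambda>i x t. exp (k * t) * D i x t) (\<lambda>i x t. exp (k * t) * D2 i x t)"
proof -
  note c = parabolic_derivsD(4-7)[OF assms, unfolded case_prod_beta]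
  have "((\<lambda>t. exp (k * t) * w x t) has_real_derivative exp (k * t) * (wt x t + k * w x t)) (at t)"
    if "0 < t" for x t
    by (rule derivative_eq_intros parabolic_derivsD(1)[OF assms that] refl)+ (simp add: algebra_simps)
  then show ?thesis
    unfolding parabolic_derivs_def case_prod_beta
    by (intro conjI allI impI DERIV_cmult parabolic_derivsD(2,3)[OF assms] continuous_intros c)
qed

text \<open>For \<open>a \<ge> 0\<close>, \<open>d > 0\<close> and
  \<open>k \<ge> 2 * a * CARD('n)\<close> this is a supersolution of the heat equation with
  coefficient \<open>a\<close>, because \<open>1 + (norm x)\<^sup>2 \<ge> 1\<close>, and it outgrows
  every linear bound.\<close>

lemma parabolic_derivs_quadratic:
  "parabolic_derivs (\<lambda>(x::real^'n) t. d * exp (k * t) * (1 + (norm x)\<^sup>2))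
     (\<lambda>x t. d * k * exp (k * t) * (1 + (norm x)\<^sup>2))
     (\<lambda>i x t. d * exp (k * t) * (2 * x $ i)) (\<lambda>i x t. d * exp (k * t) * 2)"
proof -
  have "((\<lambda>t. d * exp (k * t) * (1 + (norm x)\<^sup>2)) has_real_derivative d * k * exp (k * t) * (1 + (norm x)\<^sup>2)) (at t)"
    for x :: "real^'n" and t
    by (auto intro!: derivative_eq_intros)
  moreover have "((\<lambda>s. d * exp (k * t) * (1 + (norm (x + s *\<^sub>R axis i 1))\<^sup>2)) has_real_derivative
      d * exp (k * t) * (2 * x $ i)) (at 0)" for x :: "real^'n" and t i
  proof -
    have "(norm (x + s *\<^sub>R axis i 1))\<^sup>2 = (norm x)\<^sup>2 + 2 * s * x $ i + s\<^sup>2" for s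
      unfolding power2_norm_eq_inner
      by (simp add: inner_add_left inner_add_right inner_axis inner_axis' power2_eq_square inner_commute algebra_simps)
    then show ?thesis by (auto intro!: derivative_eq_intros)
  qed
  moreover have "((\<lambda>s. d * exp (k * t) * (2 * (x + s *\<^sub>R axis i 1) $ i)) has_real_derivative d * exp (k * t) * 2) (at 0)"
    for x :: "real^'n" and t i
    by (auto intro!: derivative_eq_intros)
  ultimately show ?thesis
    unfolding parabolic_derivs_def case_prod_beta
    by (intro conjI allI impI continuous_intros) blast+
qed

text \<open>Subtracting a small multiple of a quadratically growing supersolution makes the positive part
  compactly supported in space.\<close>

lemma maximum_principle:
  fixes w :: "real ^ 'n \<Rightarrow> real \<Rightarrow> real"
  assumes P: "parabolic_derivs w wt D D2" and a: "0 \<le> a" and k: "0 \<le> k"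
    and sub: "\<And>x t. 0 < t \<Longrightarrow> 0 < w x t \<Longrightarrow> wt x t - a * (\<Sum>i\<in>UNIV. D2 i x t) \<le> k * w x t"
    and growth: "\<And>T. 0 < T \<Longrightarrow> \<exists>C. \<forall>x. \<forall>t\<in>{0<..T}. w x t \<le> C * (1 + norm x)"
    and init: "AE x in lebesgue. \<exists>l\<le>0. (w x \<longlongrightarrow> l) (at_right 0)"
    and t: "0 < t"
  shows "w x t \<le> 0"
proof -
  define T where "T = t"
  have T: "0 < T" using t by (simp add: T_def)
  obtain C0 where C0: "\<And>x t. t \<in> {0<..T} \<Longrightarrow> w x t \<le> C0 * (1 + norm x)"
    using growth[OF T] by blast
  define C where "C = max C0 0"
  have C: "0 \<le> C" by (simp add: C_def)
  have grow: "exp (- k * t) * w x t \<le> C * (1 + norm x)" if "0 < t" "t \<le> T" for x t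
  proof (cases "0 \<le> w x t")
    case True
    have "exp (- k * t) * w x t \<le> 1 * w x t"
      using True k that by (intro mult_right_mono) auto
    also have "\<dots> \<le> C * (1 + norm x)"
      using C0[of t x] that mult_right_mono[of C0 C "1 + norm x"] by (auto simp: C_def)
    finally show ?thesis .
  next
    case False
    then have "exp (- k * t) * w x t \<le> 0" by (simp add: mult_nonneg_nonpos)
    also have "0 \<le> C * (1 + norm x)" using C by simp
    finally show ?thesis .
  qed
  \<comment> \<open>The Laplacian of \<open>1 + (norm x)\<^sup>2\<close> is
    \<open>2 * CARD('n)\<close>, so this rate makes the quadratic function a supersolution.\<close>
  define \<mu> where "\<mu> = 2 * a * real CARD('n)"
  have \<mu>: "0 \<le> \<mu>" using a by (simp add: \<mu>_def)
  have bd: "exp (- k * t) * w x t - \<delta> * exp (\<mu> * t) * (1 + (norm x)\<^sup>2) \<le> 0" if \<delta>: "0 < \<delta>" for \<delta>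
  proof -
    \<comment> \<open>For \<open>norm x \<ge> R\<close> both \<open>norm x \<ge> 1\<close> and
      \<open>\<delta> * norm x \<ge> 2 * C\<close> hold, hence \<open>\<delta> * (norm x)\<^sup>2
      \<ge> 2 * C * norm x \<ge> C * (1 + norm x)\<close>.\<close>
    define R where "R = 1 + 2 * C / \<delta>"
    have R: "0 \<le> R" using C \<delta> by (simp add: R_def)
    have low: "\<delta> * (1 + (norm x)\<^sup>2) \<le> \<delta> * exp (\<mu> * t) * (1 + (norm x)\<^sup>2)" if "0 < t" for t and x :: "real^'n"
      using that \<mu> \<delta> by (intro mult_right_mono) auto
    have far: "C * (1 + norm x) \<le> \<delta> * (1 + (norm x)\<^sup>2)" if "R \<le> norm x" for x :: "real^'n"
    proof -
      have 1: "1 \<le> norm x" "2 * C / \<delta> \<le> norm x" using that C \<delta>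
        by (auto simp: R_def intro: order_trans[rotated])
      then have "2 * C \<le> \<delta> * norm x" using \<delta> by (simp add: field_simps)
      then have "2 * C * norm x \<le> \<delta> * norm x * norm x" by (rule mult_right_mono) simp
      moreover have "C * 1 \<le> C * norm x" using 1 C by (intro mult_left_mono)
      ultimately show ?thesis using \<delta> by (simp add: power2_eq_square algebra_simps)
    qed
    show ?thesis
    proof (rule maximum_principle_compact[where T=T and R=R and M="C * (1 + R)",
          OF parabolic_derivs_diff[OF parabolic_derivs_exp_scale[OF P, of "-k"] parabolic_derivs_quadratic[of \<delta> \<mu>]] a])
      fix x and t :: real assume t: "0 < t" "t \<le> T"
      have supp: "exp (- k * t) * w x t - \<delta> * exp (\<mu> * t) * (1 + (norm x)\<^sup>2) \<le> 0" if "R \<le> norm x"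
        using grow[OF t, of x] far[OF that] low[OF t(1), of x] by linarith
      then show "R \<le> norm x \<Longrightarrow> exp (- k * t) * w x t - \<delta> * exp (\<mu> * t) * (1 + (norm x)\<^sup>2) \<le> 0" .
      show "exp (- k * t) * w x t - \<delta> * exp (\<mu> * t) * (1 + (norm x)\<^sup>2) \<le> C * (1 + R)"
      proof (cases "R \<le> norm x")
        case True
        then show ?thesis using supp C R by (meson add_nonneg_nonneg mult_nonneg_nonneg order_trans zero_le_one)
      next
        case False
        have "C * (1 + norm x) \<le> C * (1 + R)" using False C by (intro mult_left_mono) auto
        moreover have "0 \<le> \<delta> * exp (\<mu> * t) * (1 + (norm x)\<^sup>2)" using \<delta> by simp
        ultimately show ?thesis using grow[OF t, of x] by linarith
      qed
      assume pos: "0 < exp (- k * t) * w x t - \<delta> * exp (\<mu> * t) * (1 + (norm x)\<^sup>2)"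
      have "0 \<le> \<delta> * exp (\<mu> * t) * (1 + (norm x)\<^sup>2)" using \<delta> by simp
      then have "0 < exp (- k * t) * w x t" using pos by linarith
      then have w: "0 < w x t" by (simp add: zero_less_mult_iff)
      have 1: "exp (- k * t) * (wt x t + - k * w x t) \<le> exp (- k * t) * (a * (\<Sum>i\<in>UNIV. D2 i x t))"
        using sub[OF t(1) w] by (intro mult_left_mono) auto
      have "\<delta> * \<mu> * exp (\<mu> * t) * 1 \<le> \<delta> * \<mu> * exp (\<mu> * t) * (1 + (norm x)\<^sup>2)"
        using \<delta> \<mu> by (intro mult_left_mono) auto
      moreover have "a * (\<Sum>i\<in>(UNIV::'n set). \<delta> * exp (\<mu> * t) * 2) = \<delta> * \<mu> * exp (\<mu> * t)"
        by (simp add: \<mu>_def)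
      moreover have "a * (\<Sum>i\<in>UNIV. exp (- k * t) * D2 i x t - \<delta> * exp (\<mu> * t) * 2)
          = exp (- k * t) * (a * (\<Sum>i\<in>UNIV. D2 i x t)) - a * (\<Sum>i\<in>(UNIV::'n set). \<delta> * exp (\<mu> * t) * 2)"
        by (simp only: sum_subtractf sum_distrib_left[symmetric] right_diff_distrib mult.left_commute)
      ultimately show "exp (- k * t) * (wt x t + - k * w x t) - \<delta> * \<mu> * exp (\<mu> * t) * (1 + (norm x)\<^sup>2)
         \<le> a * (\<Sum>i\<in>UNIV. exp (- k * t) * D2 i x t - \<delta> * exp (\<mu> * t) * 2)"
        using 1 by linarith
    next
      show "AE x in lebesgue. \<exists>l\<le>0. ((\<lambda>t. exp (- k * t) * w x t - \<delta> * exp (\<mu> * t) * (1 + (norm x)\<^sup>2)) \<longlongrightarrow> l) (at_right 0)"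
        using init
      proof eventually_elim
        case (elim x)
        then obtain l where l: "l \<le> 0" "(w x \<longlongrightarrow> l) (at_right 0)" by blast
        have "((\<lambda>t. exp (- k * t) * w x t - \<delta> * exp (\<mu> * t) * (1 + (norm x)\<^sup>2)) \<longlongrightarrow>
            exp (- k * 0) * l - \<delta> * exp (\<mu> * 0) * (1 + (norm x)\<^sup>2)) (at_right 0)"
          by (intro tendsto_intros l)
        moreover have "exp (- k * 0) * l - \<delta> * exp (\<mu> * 0) * (1 + (norm x)\<^sup>2) \<le> 0"
          using l(1) \<delta> by (simp add: add_nonneg_nonneg le_diff_eq) (smt (verit) mult_nonneg_nonneg zero_le_power2)
        ultimately show ?case by blast
      qed
    qed (use t in \<open>auto simp: T_def\<close>)
  qed
  \<comment> \<open>With \<open>x\<close> and \<open>t\<close> fixed, the choice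
    \<open>\<delta> = e / K\<close> makes the subtracted quadratic term exactly \<open>e\<close>,
    which is arbitrary.\<close>
  define K where "K = exp (\<mu> * t) * (1 + (norm x)\<^sup>2)"
  have K: "0 < K" by (simp add: K_def add_pos_nonneg)
  have "exp (- k * t) * w x t \<le> 0"
  proof (rule field_le_epsilon)
    fix e :: real assume "0 < e"
    then have "exp (- k * t) * w x t - (e / K) * K \<le> 0"
      using bd[of "e / K"] K by (simp add: K_def mult.assoc)
    then show "exp (- k * t) * w x t \<le> 0 + e" using K by simp
  qed
  then show ?thesis by (simp add: mult_le_0_iff)
qed

text \<open>Subtracting the two inequalities leaves \<open>f (v x t) - f (u x t)\<close>. Where
  \<open>u\<close> exceeds \<open>v\<close>, this is at most \<open>L\<close> times the difference,
  so \<open>u - v\<close> satisfies the hypotheses of \<open>maximum_principle\<close> with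
  \<open>k = L\<close>.\<close>

lemma parabolic_comparison:
  fixes u v :: "real ^ 'n \<Rightarrow> real \<Rightarrow> real"
  assumes Pu: "parabolic_derivs u ut D D2" and Pv: "parabolic_derivs v vt E E2"
    and a: "0 \<le> a" and lip: "L-lipschitz_on UNIV f"
    and sub: "\<And>x t. 0 < t \<Longrightarrow> ut x t - a * (\<Sum>i\<in>UNIV. D2 i x t) + f (u x t) \<le> 0"
    and sup: "\<And>x t. 0 < t \<Longrightarrow> 0 \<le> vt x t - a * (\<Sum>i\<in>UNIV. E2 i x t) + f (v x t)"
    and gu: "\<And>T. 0 < T \<Longrightarrow> \<exists>C. \<forall>x. \<forall>t\<in>{0<..T}. \<bar>u x t\<bar> \<le> C * (1 + norm x)"
    and gv: "\<And>T. 0 < T \<Longrightarrow> \<exists>C. \<forall>x. \<forall>t\<in>{0<..T}. \<bar>v x t\<bar> \<le> C * (1 + norm x)"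
    and init: "AE x in lebesgue. \<exists>l\<le>0. ((\<lambda>t. u x t - v x t) \<longlongrightarrow> l) (at_right 0)"
    and t: "0 < t"
  shows "u x t \<le> v x t"
proof -
  have "u x t - v x t \<le> 0"
  proof (rule maximum_principle[OF parabolic_derivs_diff[OF Pu Pv] a lipschitz_on_nonneg[OF lip] _ _ init t])
    fix x and t :: real assume t: "0 < t" and pos: "0 < u x t - v x t"
    have "\<bar>f (v x t) - f (u x t)\<bar> \<le> L * (u x t - v x t)"
      using lipschitz_onD[OF lip, of "v x t" "u x t"] pos by (simp add: dist_real_def)
    then show "ut x t - vt x t - a * (\<Sum>i\<in>UNIV. D2 i x t - E2 i x t) \<le> L * (u x t - v x t)"
      using sub[OF t, of x] sup[OF t, of x] by (simp add: sum_subtractf right_diff_distrib)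
  next
    fix T :: real assume "0 < T"
    then obtain C C' where C: "\<And>x t. t \<in> {0<..T} \<Longrightarrow> \<bar>u x t\<bar> \<le> C * (1 + norm x)"
        "\<And>x t. t \<in> {0<..T} \<Longrightarrow> \<bar>v x t\<bar> \<le> C' * (1 + norm x)"
      using gu gv by meson
    have "u x t - v x t \<le> (C + C') * (1 + norm x)" if "t \<in> {0<..T}" for x t
      using C(1)[OF that, of x] C(2)[OF that, of x] by (simp add: distrib_right)
    then show "\<exists>C. \<forall>x. \<forall>t\<in>{0<..T}. u x t - v x t \<le> C * (1 + norm x)" by blast
  qed
  then show ?thesis by simp
qed

subsection \<open>Correctors and barriers\<close>

lemma periodic_continuous_bounded:
  fixes h :: "real \<Rightarrow> real"
  assumes "continuous_on UNIV h" and per: "\<And>x. h (x + 1) = h x"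
  obtains M where "0 \<le> M" "\<And>x. \<bar>h x\<bar> \<le> M"
proof -
  interpret periodic_fun_simple' h by unfold_locales (rule per)
  have "compact (h ` {0..1})"
    using assms(1) by (intro compact_continuous_image) (auto intro: continuous_on_subset)
  then obtain M where M: "\<And>x. x \<in> {0..1} \<Longrightarrow> \<bar>h x\<bar> \<le> M"
    using compact_imp_bounded bounded_real by (metis imageI)
  have "\<bar>h x\<bar> \<le> M" for x
  proof -
    have "h x = h (frac x)"
      using plus_of_int[of "frac x" "\<lfloor>x\<rfloor>"] by (simp add: frac_def)
    then show ?thesis using M[of "frac x"] frac_lt_1[of x] by simp
  qed
  moreover from this[of 0] have "0 \<le> M" by linarith
  ultimately show ?thesis using that by blast
qed

text \<open>The increment of an antiderivative over one period does not depend on the starting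
  point, and subtracting the mean of \<open>h\<close> makes it 0.\<close>

lemma periodic_antiderivative:
  fixes h :: "real \<Rightarrow> real"
  assumes cont: "continuous_on UNIV h" and per: "\<And>x. h (x + 1) = h x"
  obtains H where "\<And>x. (H has_real_derivative h x - integral {0..1} h) (at x)"
    and "\<And>x. H (x + 1) = H x"
proof -
  let ?k = "\<lambda>x. h x - integral {0..1} h"
  have "\<exists>H. \<forall>x::real. - \<infinity> < ereal x \<longrightarrow> ereal x < \<infinity> \<longrightarrow> (H has_vector_derivative ?k x) (at x)"
    using cont by (intro einterval_antiderivative) (auto intro!: continuous_intros simp: continuous_on_eq_continuous_at)
  then obtain H where H: "\<And>x. (H has_real_derivative ?k x) (at x)"
    by (auto simp: has_real_derivative_iff_has_vector_derivative)
  have "((\<lambda>x. H (x + 1) - H x) has_real_derivative 0) (at x)" for x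
  proof -
    have "((\<lambda>x. H (x + 1)) has_real_derivative ?k (x + 1)) (at x)"
      using H[of "x + 1"] by (simp add: DERIV_shift)
    from DERIV_diff[OF this H[of x]] show ?thesis by (simp add: per)
  qed
  then have const: "H (x + 1) - H x = H (0 + 1) - H 0" for x
    using DERIV_isconst_all[of "\<lambda>x. H (x + 1) - H x" x 0] by simp
  have "(?k has_integral H 1 - H 0) {0..1}"
    using H by (intro fundamental_theorem_of_calculus)
      (auto simp: has_real_derivative_iff_has_vector_derivative[symmetric] intro: has_field_derivative_at_within)
  moreover have "(?k has_integral integral {0..1} h - integral {0..1} h) {0..1}"
  proof (rule has_integral_diff)
    show "(h has_integral integral {0..1} h) {0..1}"
      by (intro integrable_integral integrable_continuous_real continuous_on_subset[OF cont]) simp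
    show "((\<lambda>x. integral {0..1} h) has_integral integral {0..1} h) {0..1::real}"
      using has_integral_const_real[of "integral {0..1} h" 0 1] by simp
  qed
  ultimately have "H 1 - H 0 = integral {0..1} h - integral {0..1} h" by (rule has_integral_unique)
  with const have "H (x + 1) = H x" for x by simp
  with H show ?thesis by (rule that)
qed

section \<open>Barrier profiles and their comparison with the solution\<close>

lemma parabolic_derivs_plane_wave:
  fixes p :: "real ^ 'n"
  assumes d1: "\<And>z. (\<phi> has_real_derivative \<phi>' z) (at z)" and d2: "\<And>z. (\<phi>' has_real_derivative \<phi>'' z) (at z)"
    and c: "continuous_on UNIV \<phi>''"
  shows "parabolic_derivs (\<lambda>x t. \<phi> (p \<bullet> x + b * t + k)) (\<lambda>x t. b * \<phi>' (p \<bullet> x + b * t + k))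
     (\<lambda>i x t. p $ i * \<phi>' (p \<bullet> x + b * t + k)) (\<lambda>i x t. (p $ i)\<^sup>2 * \<phi>'' (p \<bullet> x + b * t + k))"
proof -
  have c': "continuous_on UNIV \<phi>" "continuous_on UNIV \<phi>'"
    by (auto simp: continuous_on_eq_continuous_at intro: DERIV_isCont[OF d1] DERIV_isCont[OF d2])
  have inner: "((\<lambda>s. p \<bullet> (x + s *\<^sub>R axis i 1) + b * t + k) has_real_derivative p $ i) (at 0)" for x i t
    by (auto intro!: derivative_eq_intros simp: inner_add_right inner_axis)
  have 1: "((\<lambda>t. \<phi> (p \<bullet> x + b * t + k)) has_real_derivative b * \<phi>' (p \<bullet> x + b * t + k)) (at t)" for x t
  proof -
    have "((\<lambda>t. p \<bullet> x + b * t + k) has_real_derivative b) (at t)"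
      by (auto intro!: derivative_eq_intros)
    from DERIV_chain2[OF d1 this] show ?thesis by (simp add: mult.commute)
  qed
  have 2: "((\<lambda>s. \<phi> (p \<bullet> (x + s *\<^sub>R axis i 1) + b * t + k)) has_real_derivative p $ i * \<phi>' (p \<bullet> x + b * t + k)) (at 0)" for x t i
    using DERIV_chain2[OF d1 inner[of x i t]] by (simp add: mult.commute)
  have 3: "((\<lambda>s. p $ i * \<phi>' (p \<bullet> (x + s *\<^sub>R axis i 1) + b * t + k)) has_real_derivative
      (p $ i)\<^sup>2 * \<phi>'' (p \<bullet> x + b * t + k)) (at 0)" for x t i
    using DERIV_cmult[OF DERIV_chain2[OF d2 inner[of x i t]], of "p $ i"] by (simp add: power2_eq_square mult_ac)
  show ?thesis
    unfolding parabolic_derivs_def case_prod_beta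
    by (intro conjI allI impI 1 2 3 continuous_intros continuous_on_compose2[OF c]
        continuous_on_compose2[OF c'(1)] continuous_on_compose2[OF c'(2)]) auto
qed

lemma parabolic_derivs_time:
  assumes "\<And>t. (\<phi> has_real_derivative \<phi>' t) (at t)" and c: "continuous_on UNIV \<phi>'"
  shows "parabolic_derivs (\<lambda>x t. \<phi> t) (\<lambda>x t. \<phi>' t) (\<lambda>i x t. 0) (\<lambda>i x t. 0)"
proof -
  have c': "continuous_on UNIV \<phi>"
    by (auto simp: continuous_on_eq_continuous_at intro: DERIV_isCont[OF assms(1)])
  show ?thesis
    unfolding parabolic_derivs_def case_prod_beta
    by (auto intro!: assms(1) continuous_intros continuous_on_compose2[OF c] continuous_on_compose2[OF c'])
qed

lemma cauchy_solution_parabolic_derivs: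
  assumes "cauchy_solution \<alpha> \<epsilon> g u\<^sub>0 u"
  shows "parabolic_derivs u (\<lambda>x t. deriv (u x) t) (\<lambda>i x t. partial i (\<lambda>y. u y t) x)
           (\<lambda>i x t. partial i (partial i (\<lambda>y. u y t)) x)"
proof -
  have C: "C21 u" using assms by (simp add: cauchy_solution_def)
  have d: "(f has_real_derivative deriv f z) (at z)" if "f differentiable (at z)" for f z
    using that by (simp add: DERIV_deriv_iff_real_differentiable)
  have 1: "(u x has_real_derivative deriv (u x) t) (at t)" if "0 < t" for x t
    using C that by (intro d) (simp add: C21_def)
  have 2: "((\<lambda>s. u (x + s *\<^sub>R axis i 1) t) has_real_derivative partial i (\<lambda>y. u y t) x) (at 0)" if "0 < t" for x t i
    unfolding partial_def using C that by (intro d) (auto simp: C21_def has_partial_def)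
  have 3: "((\<lambda>s. partial i (\<lambda>y. u y t) (x + s *\<^sub>R axis i 1)) has_real_derivative
      partial i (partial i (\<lambda>y. u y t)) x) (at 0)" if "0 < t" for x t i
  proof -
    have "(\<lambda>s. partial i (\<lambda>y. u y t) (x + s *\<^sub>R axis i 1)) differentiable (at 0)"
      using C that by (auto simp: C21_def has_partial_def)
    from d[OF this] show ?thesis by (simp add: partial_def[of i "partial i (\<lambda>y. u y t)"])
  qed
  show ?thesis
    unfolding parabolic_derivs_def using C by (auto simp: 1 2 3 C21_def)
qed

text \<open>This is the form in which barriers are used: the barrier \<open>v\<close> attains its
  data \<open>v\<^sub>0\<close> everywhere, the solution attains its data almost everywhere, and the
  two data are compared almost everywhere.\<close>

lemma cauchy_solution_comparison:
  fixes u v :: "real ^ 'n \<Rightarrow> real \<Rightarrow> real"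
  assumes sol: "cauchy_solution \<alpha> \<epsilon> g u\<^sub>0 u" and \<epsilon>: "0 < \<epsilon>" and lip: "L-lipschitz_on UNIV g"
    and Pv: "parabolic_derivs v vt E E2"
    and gv: "\<And>T. 0 < T \<Longrightarrow> \<exists>C. \<forall>x. \<forall>t\<in>{0<..T}. \<bar>v x t\<bar> \<le> C * (1 + norm x)"
    and v0: "\<And>x. (v x \<longlongrightarrow> v\<^sub>0 x) (at_right 0)" and t: "0 < t"
  shows "(\<And>x t. 0 < t \<Longrightarrow> 0 \<le> vt x t - \<epsilon> powr \<alpha> * (\<Sum>i\<in>UNIV. E2 i x t) + g (v x t / \<epsilon>)) \<Longrightarrow>
      AE x in lebesgue. u\<^sub>0 x \<le> v\<^sub>0 x \<Longrightarrow> u x t \<le> v x t"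
    and "(\<And>x t. 0 < t \<Longrightarrow> vt x t - \<epsilon> powr \<alpha> * (\<Sum>i\<in>UNIV. E2 i x t) + g (v x t / \<epsilon>) \<le> 0) \<Longrightarrow>
      AE x in lebesgue. v\<^sub>0 x \<le> u\<^sub>0 x \<Longrightarrow> v x t \<le> u x t"
proof -
  note Pu = cauchy_solution_parabolic_derivs[OF sol]
  \<comment> \<open>This constant may blow up as \<epsilon> tends to 0, but it does not appear in
    the conclusion of the comparison principle.\<close>
  have lipf: "(L / \<epsilon>)-lipschitz_on UNIV (\<lambda>s. g (s / \<epsilon>))"
  proof (rule lipschitz_onI)
    show "dist (g (x / \<epsilon>)) (g (y / \<epsilon>)) \<le> L / \<epsilon> * dist x y" for x y
      using lipschitz_onD[OF lip, of "x / \<epsilon>" "y / \<epsilon>"] \<epsilon>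
      by (simp add: dist_real_def diff_divide_distrib[symmetric])
  qed (use lipschitz_on_nonneg[OF lip] \<epsilon> in simp)
  have eq: "deriv (u x) t - \<epsilon> powr \<alpha> * (\<Sum>i\<in>UNIV. partial i (partial i (\<lambda>y. u y t)) x) + g (u x t / \<epsilon>) = 0"
    if "0 < t" for x t
    using sol that by (simp add: cauchy_solution_def laplacian_def)
  have gu: "\<exists>C. \<forall>x. \<forall>t\<in>{0<..T}. \<bar>u x t\<bar> \<le> C * (1 + norm x)" if "0 < T" for T
    using sol that by (simp add: cauchy_solution_def)
  have u0: "AE x in lebesgue. (u x \<longlongrightarrow> u\<^sub>0 x) (at_right 0)"
    using sol by (simp add: cauchy_solution_def)
  show "u x t \<le> v x t" if "\<And>x t. 0 < t \<Longrightarrow> 0 \<le> vt x t - \<epsilon> powr \<alpha> * (\<Sum>i\<in>UNIV. E2 i x t) + g (v x t / \<epsilon>)"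
    "AE x in lebesgue. u\<^sub>0 x \<le> v\<^sub>0 x"
  proof (rule parabolic_comparison[OF Pu Pv _ lipf _ that(1) gu gv _ t])
    show "AE x in lebesgue. \<exists>l\<le>0. ((\<lambda>t. u x t - v x t) \<longlongrightarrow> l) (at_right 0)"
      using u0 that(2)
    proof eventually_elim
      case (elim x)
      show ?case
        by (rule exI[of _ "u\<^sub>0 x - v\<^sub>0 x"]) (use elim v0 in \<open>simp add: tendsto_diff\<close>)
    qed
  qed (simp_all add: eq)
  show "v x t \<le> u x t" if "\<And>x t. 0 < t \<Longrightarrow> vt x t - \<epsilon> powr \<alpha> * (\<Sum>i\<in>UNIV. E2 i x t) + g (v x t / \<epsilon>) \<le> 0"
    "AE x in lebesgue. v\<^sub>0 x \<le> u\<^sub>0 x"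
  proof (rule parabolic_comparison[OF Pv Pu _ lipf that(1) _ gv gu _ t])
    show "AE x in lebesgue. \<exists>l\<le>0. ((\<lambda>t. v x t - u x t) \<longlongrightarrow> l) (at_right 0)"
      using u0 that(2)
    proof eventually_elim
      case (elim x)
      show ?case
        by (rule exI[of _ "v\<^sub>0 x - u\<^sub>0 x"]) (use elim v0 in \<open>simp add: tendsto_diff\<close>)
    qed
  qed (simp_all add: eq)
qed

section \<open>Two-sided bounds in the three cases of the speed\<close>

text \<open>At \<open>y = z / \<epsilon>\<close> the diffusion term of the wave is exactly
  \<open>g y + c\<close>, because \<open>\<epsilon> powr \<alpha> * \<eta> = \<epsilon>\<close>.
  What remains in the equation is \<open>c * \<eta> * w' y\<close> and
  \<open>g (y + \<eta> * w y) - g y\<close>, both of order \<open>\<eta>\<close>. The constants are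
  chosen before \<epsilon>, the data and the solution.\<close>

lemma oscillating_plane_wave_bounds:
  fixes p :: "real ^ 'n"
  assumes p: "p \<noteq> 0" and lip: "L-lipschitz_on UNIV g" and per: "\<And>v. g (v + 1) = g v"
  obtains A B M where "0 \<le> A" "0 \<le> B"
    "\<And>\<epsilon> u\<^sub>0 u K x t. 0 < \<epsilon> \<Longrightarrow> M * \<epsilon> powr (1 - \<alpha>) \<le> 1 / 2 \<Longrightarrow> cauchy_solution \<alpha> \<epsilon> g u\<^sub>0 u \<Longrightarrow> 0 < t \<Longrightarrow>
       AE x in lebesgue. u\<^sub>0 x - p \<bullet> x \<le> K \<Longrightarrow>
       u x t \<le> p \<bullet> x + speed g p * t + K + (A * t + B * \<epsilon>) * \<epsilon> powr (1 - \<alpha>)"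
    "\<And>\<epsilon> u\<^sub>0 u K x t. 0 < \<epsilon> \<Longrightarrow> M * \<epsilon> powr (1 - \<alpha>) \<le> 1 / 2 \<Longrightarrow> cauchy_solution \<alpha> \<epsilon> g u\<^sub>0 u \<Longrightarrow> 0 < t \<Longrightarrow>
       AE x in lebesgue. K \<le> u\<^sub>0 x - p \<bullet> x \<Longrightarrow>
       p \<bullet> x + speed g p * t + K - (A * t + B * \<epsilon>) * \<epsilon> powr (1 - \<alpha>) \<le> u x t"
proof -
  define c where "c = speed g p"
  have c: "integral {0..1} g = - c" using p by (simp add: c_def speed_def)
  have contg: "continuous_on UNIV g" by (rule lipschitz_on_continuous_on[OF lip])
  \<comment> \<open>The corrector arises by integrating \<open>g\<close> twice; removing the mean of
    \<open>W\<close> before the second integration keeps \<open>V\<close> periodic.\<close>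
  obtain W where W: "\<And>x. (W has_real_derivative g x - integral {0..1} g) (at x)" "\<And>x. W (x + 1) = W x"
    using periodic_antiderivative[OF contg per] by blast
  have contW: "continuous_on UNIV W"
    by (auto simp: continuous_on_eq_continuous_at intro: DERIV_isCont[OF W(1)])
  obtain V where V: "\<And>x. (V has_real_derivative W x - integral {0..1} W) (at x)" "\<And>x. V (x + 1) = V x"
    using periodic_antiderivative[OF contW W(2)] by blast
  define N where "N = (norm p)\<^sup>2"
  have N: "0 < N" using p by (simp add: N_def)
  have sumN: "(\<Sum>i\<in>UNIV. (p $ i)\<^sup>2 * y) = N * y" for y
    unfolding N_def power2_norm_eq_inner inner_vec_def by (simp add: power2_eq_square sum_distrib_right)
  define w w' w'' where "w z = V z / N" and "w' z = (W z - integral {0..1} W) / N" and "w'' z = (g z + c) / N" for z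
  have dw: "(w has_real_derivative w' z) (at z)" for z
    unfolding w_def[abs_def] w'_def by (rule DERIV_cdivide[OF V(1)])
  have dw': "(w' has_real_derivative w'' z) (at z)" for z
    using DERIV_cdivide[OF DERIV_diff[OF W(1) DERIV_const]] by (simp add: w'_def[abs_def] w''_def c)
  have contw'': "continuous_on UNIV w''"
    unfolding w''_def by (intro continuous_intros contg) (use N in auto)
  obtain M0 where M0: "0 \<le> M0" "\<And>z. \<bar>w z\<bar> \<le> M0"
    by (rule periodic_continuous_bounded[of w])
      (auto simp: w_def V continuous_on_eq_continuous_at intro!: DERIV_isCont[OF V(1)] DERIV_isCont[OF dw[unfolded w_def[abs_def]]])
  obtain M1 where M1: "0 \<le> M1" "\<And>z. \<bar>w' z\<bar> \<le> M1"
    by (rule periodic_continuous_bounded[of w'])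
      (auto simp: w'_def W continuous_on_eq_continuous_at intro!: DERIV_isCont[OF dw'[unfolded w'_def[abs_def]]])
  have L: "0 \<le> L" by (rule lipschitz_on_nonneg[OF lip])
  \<comment> \<open>The two summands bound, up to the factor \<open>\<eta>\<close>, the errors from
    \<open>c * \<eta> * w'\<close> and from shifting the argument of \<open>g\<close> by
    \<open>\<eta> * w\<close>. The factor 2 compensates for a phase derivative that may be as small
    as 1/2.\<close>
  define A where "A = 2 * (\<bar>c\<bar> * M1 + L * M0)"
  have A: "0 \<le> A" using M0 M1 L by (simp add: A_def)
  define \<phi> where "\<phi> \<epsilon> z = z + \<epsilon> * \<epsilon> powr (1 - \<alpha>) * w (z / \<epsilon>)" for \<epsilon> z
  \<comment> \<open>The sign \<open>\<sigma> = 1\<close> gives the upper barrier and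
    \<open>\<sigma> = -1\<close> the lower one. The shift containing \<open>M0\<close> outweighs the
    corrector, so that at time 0 the barrier lies on the correct side of
    \<open>p \<bullet> x + K\<close>.\<close>
  define v where "v \<sigma> \<epsilon> K x t = \<phi> \<epsilon> (p \<bullet> x + (c + \<sigma> * A * \<epsilon> powr (1 - \<alpha>)) * t + (K + \<sigma> * \<epsilon> * \<epsilon> powr (1 - \<alpha>) * M0))"
    for \<sigma> \<epsilon> K t and x :: "real ^ 'n"
  have main: "(\<exists>vt E E2. parabolic_derivs (v \<sigma> \<epsilon> K) vt E E2 \<and>
        (\<forall>x t. 0 \<le> \<sigma> * (vt x t - \<epsilon> powr \<alpha> * (\<Sum>i\<in>UNIV. E2 i x t) + g (v \<sigma> \<epsilon> K x t / \<epsilon>)))) \<and>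
      (\<forall>T>0. \<exists>C. \<forall>x. \<forall>t\<in>{0<..T}. \<bar>v \<sigma> \<epsilon> K x t\<bar> \<le> C * (1 + norm x)) \<and>
      (\<forall>x. (v \<sigma> \<epsilon> K x \<longlongrightarrow> v \<sigma> \<epsilon> K x 0) (at_right 0)) \<and>
      (\<forall>x t. \<bar>v \<sigma> \<epsilon> K x t - (p \<bullet> x + (c + \<sigma> * A * \<epsilon> powr (1 - \<alpha>)) * t + (K + \<sigma> * \<epsilon> * \<epsilon> powr (1 - \<alpha>) * M0))\<bar>
        \<le> \<epsilon> * \<epsilon> powr (1 - \<alpha>) * M0)"
    if \<epsilon>: "0 < \<epsilon>" and small: "M1 * \<epsilon> powr (1 - \<alpha>) \<le> 1 / 2" and \<sigma>: "\<sigma> = 1 \<or> \<sigma> = -1" for \<sigma> \<epsilon> K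
  proof -
    define \<eta> where "\<eta> = \<epsilon> powr (1 - \<alpha>)"
    have \<eta>: "0 < \<eta>" using \<epsilon> by (simp add: \<eta>_def)
    have pw: "\<epsilon> powr \<alpha> * \<eta> = \<epsilon>"
      using \<epsilon> by (simp add: \<eta>_def powr_add[symmetric])
    define b where "b = c + \<sigma> * A * \<eta>"
    define k where "k = K + \<sigma> * \<epsilon> * \<eta> * M0"
    have veq: "v \<sigma> \<epsilon> K = (\<lambda>x t. \<phi> \<epsilon> (p \<bullet> x + b * t + k))"
      by (simp add: v_def b_def k_def \<eta>_def fun_eq_iff)
    have \<phi>eq: "\<phi> \<epsilon> z = z + \<epsilon> * \<eta> * w (z / \<epsilon>)" for z by (simp add: \<phi>_def \<eta>_def)
    have d1: "(\<phi> \<epsilon> has_real_derivative 1 + \<eta> * w' (z / \<epsilon>)) (at z)" for z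
    proof -
      have "((\<lambda>z. w (z / \<epsilon>)) has_real_derivative w' (z / \<epsilon>) * (1 / \<epsilon>)) (at z)"
        by (rule DERIV_chain2[OF dw]) (use \<epsilon> in \<open>auto intro!: derivative_eq_intros\<close>)
      from DERIV_add[OF DERIV_ident DERIV_cmult[OF this, of "\<epsilon> * \<eta>"]] \<epsilon>
      show ?thesis by (simp add: \<phi>eq[abs_def])
    qed
    have d2: "((\<lambda>z. 1 + \<eta> * w' (z / \<epsilon>)) has_real_derivative \<eta> / \<epsilon> * w'' (z / \<epsilon>)) (at z)" for z
    proof -
      have "((\<lambda>z. w' (z / \<epsilon>)) has_real_derivative w'' (z / \<epsilon>) * (1 / \<epsilon>)) (at z)"
        by (rule DERIV_chain2[OF dw']) (use \<epsilon> in \<open>auto intro!: derivative_eq_intros\<close>)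
      from DERIV_add[OF DERIV_const[of 1] DERIV_cmult[OF this, of "\<eta>"]]
      show ?thesis by (simp add: mult_ac)
    qed
    have cont: "continuous_on UNIV (\<lambda>z. \<eta> / \<epsilon> * w'' (z / \<epsilon>))"
      using \<epsilon> by (intro continuous_intros continuous_on_compose2[OF contw'']) auto
    \<comment> \<open>Multiplying the residual by \<open>\<sigma>\<close> treats the supersolution
      and the subsolution inequality at once.\<close>
    have res: "0 \<le> \<sigma> * (b * (1 + \<eta> * w' (z / \<epsilon>)) - \<epsilon> powr \<alpha> * (\<Sum>i\<in>UNIV. (p $ i)\<^sup>2 * (\<eta> / \<epsilon> * w'' (z / \<epsilon>))) + g (\<phi> \<epsilon> z / \<epsilon>))" for z
    proof -
      define y where "y = z / \<epsilon>"
      have "\<epsilon> powr \<alpha> * (\<Sum>i\<in>UNIV. (p $ i)\<^sup>2 * (\<eta> / \<epsilon> * w'' y)) = (\<epsilon> powr \<alpha> * \<eta>) / \<epsilon> * (N * w'' y)"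
        unfolding sumN by simp
      also have "\<dots> = g y + c" using \<epsilon> N by (simp add: pw w''_def)
      finally have 1: "\<epsilon> powr \<alpha> * (\<Sum>i\<in>UNIV. (p $ i)\<^sup>2 * (\<eta> / \<epsilon> * w'' y)) = g y + c" .
      have 2: "\<phi> \<epsilon> z / \<epsilon> = y + \<eta> * w y" using \<epsilon> by (simp add: \<phi>eq y_def add_divide_distrib)
      have "\<bar>g (y + \<eta> * w y) - g y\<bar> \<le> L * (\<eta> * \<bar>w y\<bar>)"
        using lipschitz_onD[OF lip, of "y + \<eta> * w y" y] \<eta> by (simp add: dist_real_def abs_mult)
      also have "\<dots> \<le> L * (\<eta> * M0)" using L \<eta> M0(2)[of y] by (intro mult_left_mono) auto
      finally have 3: "\<bar>g (y + \<eta> * w y) - g y\<bar> \<le> \<eta> * (L * M0)" by (simp add: mult_ac)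
      have "\<bar>c * (\<eta> * w' y)\<bar> = \<bar>c\<bar> * (\<eta> * \<bar>w' y\<bar>)" using \<eta> by (simp add: abs_mult)
      also have "\<dots> \<le> \<bar>c\<bar> * (\<eta> * M1)" using \<eta> M1(2)[of y] by (intro mult_left_mono) auto
      finally have 4: "\<bar>c * (\<eta> * w' y)\<bar> \<le> \<eta> * (\<bar>c\<bar> * M1)" by (simp add: mult_ac)
      have "\<bar>\<eta> * w' y\<bar> \<le> \<eta> * M1" using M1(2)[of y] \<eta> by (simp add: abs_mult)
      \<comment> \<open>Smallness of \<epsilon> enters here: the speed correction
        \<open>A * \<eta>\<close> keeps at least half of its effect.\<close>
      then have "1 / 2 \<le> 1 + \<eta> * w' y" using small by (simp add: \<eta>_def mult.commute abs_le_iff)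
      then have 5: "A * \<eta> * (1 / 2) \<le> A * \<eta> * (1 + \<eta> * w' y)" using A \<eta> by (intro mult_left_mono) auto
      have half: "A * \<eta> * (1 / 2) = \<eta> * (\<bar>c\<bar> * M1) + \<eta> * (L * M0)" by (simp add: A_def algebra_simps)
      have "0 \<le> A * \<eta> * (1 + \<eta> * w' y) + \<sigma> * (c * (\<eta> * w' y) + (g (y + \<eta> * w y) - g y))"
        using 3 4 5 half \<sigma> by auto
      also have "\<dots> = \<sigma> * (b * (1 + \<eta> * w' y) - (g y + c) + g (y + \<eta> * w y))"
        using \<sigma> by (auto simp: b_def algebra_simps)
      finally show ?thesis unfolding 2 y_def[symmetric] 1 .
    qed
    have close: "\<bar>\<phi> \<epsilon> z - z\<bar> \<le> \<epsilon> * \<eta> * M0" for z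
      using M0(2)[of "z / \<epsilon>"] \<epsilon> \<eta> by (simp add: \<phi>eq abs_mult)
    have growth: "\<exists>C. \<forall>x. \<forall>t\<in>{0<..T}. \<bar>v \<sigma> \<epsilon> K x t\<bar> \<le> C * (1 + norm x)" if "0 < T" for T
    proof (intro exI allI ballI)
      fix x :: "real^'n" and t assume t: "t \<in> {0<..T}"
      define R where "R = \<bar>b\<bar> * T + \<bar>k\<bar> + \<epsilon> * \<eta> * M0"
      have "\<bar>b * t\<bar> \<le> \<bar>b\<bar> * T" using t by (auto simp: abs_mult intro!: mult_left_mono)
      moreover have "\<bar>p \<bullet> x\<bar> \<le> norm p * norm x" by (rule Cauchy_Schwarz_ineq2)
      ultimately have "\<bar>v \<sigma> \<epsilon> K x t\<bar> \<le> norm p * norm x + R"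
        using close[of "p \<bullet> x + b * t + k"] by (simp add: veq R_def)
      also have "\<dots> \<le> norm p * (1 + norm x) + R * (1 + norm x)"
      proof -
        have "0 \<le> R" using that \<epsilon> \<eta> M0 by (simp add: R_def)
        then have "0 \<le> R * norm x" by simp
        then show ?thesis by (simp add: distrib_left)
      qed
      finally show "\<bar>v \<sigma> \<epsilon> K x t\<bar> \<le> (norm p + (\<bar>b\<bar> * T + \<bar>k\<bar> + \<epsilon> * \<eta> * M0)) * (1 + norm x)"
        unfolding R_def[symmetric] by (simp add: distrib_right)
    qed
    have lim: "(v \<sigma> \<epsilon> K x \<longlongrightarrow> v \<sigma> \<epsilon> K x 0) (at_right 0)" for x
    proof -
      have "((\<lambda>t. p \<bullet> x + b * t + k) \<longlongrightarrow> p \<bullet> x + b * 0 + k) (at_right 0)" by (intro tendsto_intros)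
      from isCont_tendsto_compose[OF DERIV_isCont[OF d1] this] show ?thesis by (simp add: veq)
    qed
    have pd: "parabolic_derivs (v \<sigma> \<epsilon> K) (\<lambda>x t. b * (1 + \<eta> * w' ((p \<bullet> x + b * t + k) / \<epsilon>)))
        (\<lambda>i x t. p $ i * (1 + \<eta> * w' ((p \<bullet> x + b * t + k) / \<epsilon>)))
        (\<lambda>i x t. (p $ i)\<^sup>2 * (\<eta> / \<epsilon> * w'' ((p \<bullet> x + b * t + k) / \<epsilon>)))"
      unfolding veq by (rule parabolic_derivs_plane_wave[OF d1 d2 cont])
    show ?thesis
    proof (intro conjI allI impI)
      show "\<exists>vt E E2. parabolic_derivs (v \<sigma> \<epsilon> K) vt E E2 \<and>
        (\<forall>x t. 0 \<le> \<sigma> * (vt x t - \<epsilon> powr \<alpha> * (\<Sum>i\<in>UNIV. E2 i x t) + g (v \<sigma> \<epsilon> K x t / \<epsilon>)))"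
        by (intro exI conjI, rule pd) (use res in \<open>simp add: veq\<close>)
      show "\<bar>v \<sigma> \<epsilon> K x t - (p \<bullet> x + (c + \<sigma> * A * \<epsilon> powr (1 - \<alpha>)) * t + (K + \<sigma> * \<epsilon> * \<epsilon> powr (1 - \<alpha>) * M0))\<bar>
        \<le> \<epsilon> * \<epsilon> powr (1 - \<alpha>) * M0" for x t
        using close[of "p \<bullet> x + b * t + k"] by (simp only: veq b_def k_def \<eta>_def)
    qed (fact growth lim)+
  qed
  show ?thesis
  \<comment> \<open>One \<open>M0\<close> pays for the initial shift of the barrier, the other for
    the oscillation of the corrector.\<close>
  proof (rule that[of A "2 * M0" M1])
    fix \<epsilon> K x t and u\<^sub>0 :: "real ^ 'n \<Rightarrow> real" and u
    assume \<epsilon>: "0 < \<epsilon>" and small: "M1 * \<epsilon> powr (1 - \<alpha>) \<le> 1 / 2" and sol: "cauchy_solution \<alpha> \<epsilon> g u\<^sub>0 u" and t: "(0::real) < t"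
    {
      assume init: "AE x in lebesgue. u\<^sub>0 x - p \<bullet> x \<le> K"
      note m = main[OF \<epsilon> small, of 1 K, simplified]
      from m obtain vt E E2 where 1: "parabolic_derivs (v 1 \<epsilon> K) vt E E2"
        "\<And>x t. 0 \<le> vt x t - \<epsilon> powr \<alpha> * (\<Sum>i\<in>UNIV. E2 i x t) + g (v 1 \<epsilon> K x t / \<epsilon>)" by blast
      have close: "\<bar>v 1 \<epsilon> K x t - (p \<bullet> x + (c + A * \<epsilon> powr (1 - \<alpha>)) * t + (K + \<epsilon> * \<epsilon> powr (1 - \<alpha>) * M0))\<bar>
        \<le> \<epsilon> * \<epsilon> powr (1 - \<alpha>) * M0" for x t using m by blast
      have "u x t \<le> v 1 \<epsilon> K x t"
      proof (rule cauchy_solution_comparison(1)[OF sol \<epsilon> lip 1(1) _ _ t 1(2)])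
        show "AE x in lebesgue. u\<^sub>0 x \<le> v 1 \<epsilon> K x 0"
          using init
        proof eventually_elim
          case (elim x)
          then show ?case using close[of x 0] by (simp add: abs_le_iff)
        qed
      qed (use m in auto)
      then show "u x t \<le> p \<bullet> x + speed g p * t + K + (A * t + 2 * M0 * \<epsilon>) * \<epsilon> powr (1 - \<alpha>)"
        using close[of x t] by (simp add: abs_le_iff c_def algebra_simps)
    }
    {
      assume init: "AE x in lebesgue. K \<le> u\<^sub>0 x - p \<bullet> x"
      note m = main[OF \<epsilon> small, of "-1" K, simplified]
      from m obtain vt E E2 where 1: "parabolic_derivs (v (-1) \<epsilon> K) vt E E2"
        "\<And>x t. vt x t - \<epsilon> powr \<alpha> * (\<Sum>i\<in>UNIV. E2 i x t) + g (v (-1) \<epsilon> K x t / \<epsilon>) \<le> 0"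
        by (force simp: algebra_simps)
      have close: "\<bar>v (-1) \<epsilon> K x t - (p \<bullet> x + (c - A * \<epsilon> powr (1 - \<alpha>)) * t + (K - \<epsilon> * \<epsilon> powr (1 - \<alpha>) * M0))\<bar>
        \<le> \<epsilon> * \<epsilon> powr (1 - \<alpha>) * M0" for x t using m by simp
      have "v (-1) \<epsilon> K x t \<le> u x t"
      proof (rule cauchy_solution_comparison(2)[OF sol \<epsilon> lip 1(1) _ _ t 1(2)])
        show "AE x in lebesgue. v (-1) \<epsilon> K x 0 \<le> u\<^sub>0 x"
          using init
        proof eventually_elim
          case (elim x)
          then show ?case using close[of x 0] by (simp add: abs_le_iff)
        qed
      qed (use m in auto)
      then show "p \<bullet> x + speed g p * t + K - (A * t + 2 * M0 * \<epsilon>) * \<epsilon> powr (1 - \<alpha>) \<le> u x t"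
        using close[of x t] by (simp add: abs_le_iff c_def algebra_simps)
    }
  qed (use A M0 in auto)
qed

text \<open>A function of time solving \<open>\<phi>' = - g (\<phi> / \<epsilon>)\<close> exactly
  serves as barrier from both sides. Separating variables with \<open>F' = - 1 / g\<close>, the
  quantity \<open>F (\<phi> / \<epsilon>) - t / \<epsilon>\<close> is constant; since
  \<open>F\<close> is linear of slope \<open>m\<close> up to a bounded periodic term,
  \<open>\<phi>\<close> stays within order \<epsilon> of a line of slope \<open>1 / m\<close>, at
  all times.\<close>

lemma parabolic_flat_bounds_negative:
  assumes neg: "\<And>s. g s < 0" and lip: "L-lipschitz_on UNIV g" and per: "\<And>v. g (v + 1) = g v"
  obtains B where "0 \<le> B"
    "\<And>\<epsilon> (u\<^sub>0 :: real ^ 'n \<Rightarrow> real) u K x t. 0 < \<epsilon> \<Longrightarrow> cauchy_solution \<alpha> \<epsilon> g u\<^sub>0 u \<Longrightarrow> 0 < t \<Longrightarrow>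
       AE x in lebesgue. u\<^sub>0 x \<le> K \<Longrightarrow> u x t \<le> speed g (0 :: real ^ 'n) * t + K + B * \<epsilon>"
    "\<And>\<epsilon> (u\<^sub>0 :: real ^ 'n \<Rightarrow> real) u K x t. 0 < \<epsilon> \<Longrightarrow> cauchy_solution \<alpha> \<epsilon> g u\<^sub>0 u \<Longrightarrow> 0 < t \<Longrightarrow>
       AE x in lebesgue. K \<le> u\<^sub>0 x \<Longrightarrow> speed g (0 :: real ^ 'n) * t + K - B * \<epsilon> \<le> u x t"
proof -
  have contg: "continuous_on UNIV g" by (rule lipschitz_on_continuous_on[OF lip])
  define h where "h s = - (1 / g s)" for s
  have hpos: "0 < h s" for s using neg[of s] by (simp add: h_def)
  have conth: "continuous_on UNIV h"
    unfolding h_def[abs_def] using neg by (auto intro!: continuous_intros contg simp: less_imp_neq)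
  have perh: "h (s + 1) = h s" for s by (simp add: h_def per)
  define m where "m = integral {0..1} h"
  have m: "speed g (0 :: real ^ 'n) = inverse m"
    using neg by (simp add: speed_def m_def h_def[abs_def])
  obtain H where H: "\<And>x. (H has_real_derivative h x - m) (at x)" "\<And>x. H (x + 1) = H x"
    using periodic_antiderivative[OF conth perh] unfolding m_def by blast
  obtain M where M: "0 \<le> M" "\<And>z. \<bar>H z\<bar> \<le> M"
    by (rule periodic_continuous_bounded[of H])
      (auto simp: H continuous_on_eq_continuous_at intro!: DERIV_isCont[OF H(1)])
  \<comment> \<open>An antiderivative of \<open>h\<close>, split into its periodic part and its mean
    growth.\<close>
  define F where "F z = H z + m * z" for z
  have dF: "(F has_real_derivative h z) (at z)" for z
    unfolding F_def[abs_def] using DERIV_add[OF H(1) DERIV_cmult[OF DERIV_ident, of m]] by simp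
  have F_less: "F a < F b" if "a < b" for a b
    using DERIV_pos_imp_increasing[OF that, of F] dF hpos by blast
  have contF: "continuous_on S F" for S
    by (rule continuous_at_imp_continuous_on) (blast intro: DERIV_isCont dF)
  have mpos: "0 < m" using F_less[of 0 1] H(2)[of 0] by (simp add: F_def)
  have injF: "inj F"
    by (rule linorder_injI) (metis F_less less_irrefl)
  \<comment> \<open>\<open>F\<close> differs from \<open>m * z\<close> by at most \<open>M\<close>,
    so \<open>y\<close> lies between the values of \<open>F\<close> at \<open>(y - M) / m\<close>
    and \<open>(y + M) / m\<close>.\<close>
  have surjF: "\<exists>z. F z = y" for y
  proof -
    have "F ((y - M) / m) \<le> y" "y \<le> F ((y + M) / m)"
      using M(2)[of "(y - M) / m"] M(2)[of "(y + M) / m"] mpos by (auto simp: F_def abs_le_iff)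
    moreover have "(y - M) / m \<le> (y + M) / m" using mpos M by (simp add: divide_right_mono)
    ultimately show ?thesis using IVT'[of F _ y, OF _ _ _ contF] by blast
  qed
  define G where "G = inv F"
  have FG: "F (G y) = y" for y unfolding G_def by (rule f_inv_into_f) (use surjF in \<open>metis rangeI\<close>)
  have GF: "G (F z) = z" for z unfolding G_def by (rule inv_f_f[OF injF])
  \<comment> \<open>The reciprocal of \<open>h\<close> is \<open>- g\<close>, which makes the
    inverse of \<open>F\<close> solve the autonomous equation.\<close>
  have dG: "(G has_real_derivative - g (G y)) (at y)" for y
  proof -
    have "(G has_derivative (*) (- g (G y))) (at y)"
    proof (rule has_derivative_inverse_strong_x[of UNIV G y F "(*) (h (G y))"])
      show "(F has_derivative (*) (h (G y))) (at (G y))"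
        using dF by (simp add: has_field_derivative_def)
      show "(*) (h (G y)) \<circ> (*) (- g (G y)) = id"
        using neg[of "G y"] by (auto simp: h_def fun_eq_iff)
    qed (auto simp: FG GF contF)
    then show ?thesis by (simp add: has_field_derivative_def)
  qed
  have contG: "continuous_on UNIV G"
    by (rule continuous_at_imp_continuous_on) (blast intro: DERIV_isCont dG)
  have main: "(\<exists>v :: real ^ 'n \<Rightarrow> real \<Rightarrow> real. \<exists>vt E E2. parabolic_derivs v vt E E2 \<and>
      (\<forall>x t. vt x t - \<epsilon> powr \<alpha> * (\<Sum>i\<in>UNIV. E2 i x t) + g (v x t / \<epsilon>) = 0) \<and>
      (\<forall>T>0. \<exists>C. \<forall>x. \<forall>t\<in>{0<..T}. \<bar>v x t\<bar> \<le> C * (1 + norm x)) \<and>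
      (\<forall>x. (v x \<longlongrightarrow> K) (at_right 0)) \<and>
      (\<forall>x. \<forall>t. \<bar>v x t - (speed g (0 :: real ^ 'n) * t + K)\<bar> \<le> (2 * M / m) * \<epsilon>))"
    if \<epsilon>: "0 < \<epsilon>" for \<epsilon> K
  proof -
    \<comment> \<open>The equation is solved in the fast variables \<open>t / \<epsilon>\<close> and
      \<open>\<phi> / \<epsilon>\<close>; the offset \<open>F (K / \<epsilon>)\<close> makes the
      initial value \<open>K\<close>.\<close>
    define \<phi> where "\<phi> t = \<epsilon> * G (t / \<epsilon> + F (K / \<epsilon>))" for t
    have d: "(\<phi> has_real_derivative - g (G (t / \<epsilon> + F (K / \<epsilon>)))) (at t)" for t
    proof -
      have "((\<lambda>t. t / \<epsilon> + F (K / \<epsilon>)) has_real_derivative 1 / \<epsilon>) (at t)"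
        using \<epsilon> by (auto intro!: derivative_eq_intros)
      from DERIV_cmult[OF DERIV_chain2[OF dG this], of \<epsilon>] \<epsilon> show ?thesis by (simp add: \<phi>_def[abs_def])
    qed
    have \<phi>0: "\<phi> 0 = K" using \<epsilon> by (simp add: \<phi>_def GF)
    \<comment> \<open>Multiplied by \<epsilon>, the identity \<open>F (G y) = y\<close> has linear
      parts that give exactly the line; only a difference of two values of \<open>H\<close>, at most
      \<open>2 * M\<close>, is left.\<close>
    have close: "\<bar>\<phi> t - (speed g (0 :: real ^ 'n) * t + K)\<bar> \<le> (2 * M / m) * \<epsilon>" for t
    proof -
      let ?z = "G (t / \<epsilon> + F (K / \<epsilon>))"
      have "H ?z + m * ?z = t / \<epsilon> + (H (K / \<epsilon>) + m * (K / \<epsilon>))"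
        using FG[of "t / \<epsilon> + F (K / \<epsilon>)"] by (simp add: F_def)
      then have "\<epsilon> * (H ?z + m * ?z) = \<epsilon> * (t / \<epsilon> + (H (K / \<epsilon>) + m * (K / \<epsilon>)))" by simp
      then have "m * \<phi> t - t - m * K = \<epsilon> * (H (K / \<epsilon>) - H ?z)"
        using \<epsilon> by (simp add: \<phi>_def algebra_simps)
      then have "\<phi> t - (speed g (0 :: real ^ 'n) * t + K) = \<epsilon> * (H (K / \<epsilon>) - H ?z) / m"
        using mpos by (simp add: m field_simps)
      moreover have "\<bar>\<epsilon> * (H (K / \<epsilon>) - H ?z) / m\<bar> = \<epsilon> * \<bar>H (K / \<epsilon>) - H ?z\<bar> / m"
        using \<epsilon> mpos by (simp add: abs_mult)
      moreover have "\<epsilon> * \<bar>H (K / \<epsilon>) - H ?z\<bar> / m \<le> \<epsilon> * (2 * M) / m"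
        using M(2)[of "K / \<epsilon>"] M(2)[of ?z] \<epsilon> mpos by (intro divide_right_mono mult_left_mono) auto
      ultimately show ?thesis by (simp add: mult_ac)
    qed
    have cont\<phi>': "continuous_on UNIV (\<lambda>t. - g (G (t / \<epsilon> + F (K / \<epsilon>))))"
      by (intro continuous_intros continuous_on_compose2[OF contg] continuous_on_compose2[OF contG])
        (use \<epsilon> in auto)
    show ?thesis
    proof (intro exI conjI allI impI)
      show "parabolic_derivs (\<lambda>x t. \<phi> t) (\<lambda>x t. - g (G (t / \<epsilon> + F (K / \<epsilon>)))) (\<lambda>(i::'n) x t. 0) (\<lambda>i x t. 0)"
        by (rule parabolic_derivs_time[OF d cont\<phi>'])
      show "- g (G (t / \<epsilon> + F (K / \<epsilon>))) - \<epsilon> powr \<alpha> * (\<Sum>i\<in>(UNIV::'n set). 0) + g (\<phi> t / \<epsilon>) = 0" for t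
        using \<epsilon> by (simp add: \<phi>_def)
      show "(\<phi> \<longlongrightarrow> K) (at_right 0)"
        using DERIV_isCont[OF d, of 0] unfolding isCont_def \<phi>0 by (rule tendsto_mono[rotated]) (simp add: at_le)
      show "\<bar>\<phi> t - (speed g (0 :: real ^ 'n) * t + K)\<bar> \<le> (2 * M / m) * \<epsilon>" for t by (rule close)
      fix T :: real assume T: "0 < T"
      let ?C = "speed g (0 :: real ^ 'n) * T + \<bar>K\<bar> + (2 * M / m) * \<epsilon>"
      have C: "0 \<le> ?C" using T mpos M \<epsilon> by (simp add: m)
      have "\<bar>\<phi> t\<bar> \<le> ?C * (1 + norm x)" if "t \<in> {0<..T}" for t and x :: "real^'n"
      proof -
        have "0 \<le> speed g (0 :: real ^ 'n) * t" "speed g (0 :: real ^ 'n) * t \<le> speed g (0 :: real ^ 'n) * T"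
          using that mpos by (auto simp: m)
        then have "\<bar>\<phi> t\<bar> \<le> ?C" using close[of t] by linarith
        also have "\<dots> = ?C * 1" by simp
        also have "\<dots> \<le> ?C * (1 + norm x)" using C by (intro mult_left_mono) auto
        finally show ?thesis .
      qed
      then show "\<forall>t\<in>{0<..T}. \<bar>\<phi> t\<bar> \<le> ?C * (1 + norm x)" for x :: "real^'n" by blast
    qed
  qed
  show ?thesis
  proof (rule that[of "2 * M / m"])
    fix \<epsilon> K t and u\<^sub>0 :: "real ^ 'n \<Rightarrow> real" and u x
    assume \<epsilon>: "0 < \<epsilon>" and sol: "cauchy_solution \<alpha> \<epsilon> g u\<^sub>0 u" and t: "(0::real) < t"
    from main[OF \<epsilon>, of K] obtain v :: "real ^ 'n \<Rightarrow> real \<Rightarrow> real" and vt E E2 where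
      1: "parabolic_derivs v vt E E2"
      and eq: "\<And>x t. vt x t - \<epsilon> powr \<alpha> * (\<Sum>i\<in>UNIV. E2 i x t) + g (v x t / \<epsilon>) = 0"
      and growth: "\<And>T. 0 < T \<Longrightarrow> \<exists>C. \<forall>x. \<forall>t\<in>{0<..T}. \<bar>v x t\<bar> \<le> C * (1 + norm x)"
      and lim: "\<And>x. (v x \<longlongrightarrow> K) (at_right 0)"
      and close: "\<And>x t. \<bar>v x t - (speed g (0 :: real ^ 'n) * t + K)\<bar> \<le> (2 * M / m) * \<epsilon>"
      by blast
    note cmp = cauchy_solution_comparison[OF sol \<epsilon> lip 1 growth lim t, of x]
    show "u x t \<le> speed g (0 :: real ^ 'n) * t + K + 2 * M / m * \<epsilon>" if "AE x in lebesgue. u\<^sub>0 x \<le> K"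
      using cmp(1)[OF _ _ that] eq close[of x t] by (simp add: abs_le_iff)
    show "speed g (0 :: real ^ 'n) * t + K - 2 * M / m * \<epsilon> \<le> u x t" if "AE x in lebesgue. K \<le> u\<^sub>0 x"
      using cmp(2)[OF _ _ that] eq close[of x t] by (simp add: abs_le_iff)
  qed (use M mpos in auto)
qed

text \<open>For a constant all derivative terms drop out, and the sign of
  \<open>g (k / \<epsilon>)\<close> alone decides whether it is a super- or a subsolution.\<close>

lemma cauchy_solution_constant_comparison:
  fixes u :: "real ^ 'n \<Rightarrow> real \<Rightarrow> real"
  assumes "cauchy_solution \<alpha> \<epsilon> g u\<^sub>0 u" "0 < \<epsilon>" "L-lipschitz_on UNIV g" "0 < t"
  shows "0 \<le> g (k / \<epsilon>) \<Longrightarrow> AE x in lebesgue. u\<^sub>0 x \<le> k \<Longrightarrow> u x t \<le> k"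
    and "g (k / \<epsilon>) \<le> 0 \<Longrightarrow> AE x in lebesgue. k \<le> u\<^sub>0 x \<Longrightarrow> k \<le> u x t"
proof -
  have P: "parabolic_derivs (\<lambda>(x::real^'n) t. k) (\<lambda>x t. 0) (\<lambda>i x t. 0) (\<lambda>i x t. 0)"
    by (rule parabolic_derivs_time) auto
  have growth: "\<exists>C. \<forall>x::real^'n. \<forall>t\<in>{0<..T}. \<bar>k\<bar> \<le> C * (1 + norm x)" for T :: real
    by (intro exI[of _ "\<bar>k\<bar>"]) (auto simp: mult_le_cancel_left1 algebra_simps)
  note cmp = cauchy_solution_comparison[OF assms(1-3) P growth tendsto_const assms(4), of x]
  show "u x t \<le> k" if "0 \<le> g (k / \<epsilon>)" "AE x in lebesgue. u\<^sub>0 x \<le> k"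
    using cmp(1)[OF _ that(2)] that(1) by simp
  show "k \<le> u x t" if "g (k / \<epsilon>) \<le> 0" "AE x in lebesgue. k \<le> u\<^sub>0 x"
    using cmp(2)[OF _ that(2)] that(1) by simp
qed

text \<open>Since \<open>g\<close> is nonpositive, every constant is a subsolution, so the lower
  bound has no error. From above a zero of \<open>g (k / \<epsilon>)\<close> is needed, and
  periodicity provides one within distance \<epsilon> above \<open>K\<close>.\<close>

lemma parabolic_flat_bounds_vanishing:
  fixes u :: "real ^ 'n \<Rightarrow> real \<Rightarrow> real"
  assumes zero: "g z = 0" and nonpos: "\<And>s. g s \<le> 0" and lip: "L-lipschitz_on UNIV g" and per: "\<And>v. g (v + 1) = g v"
    and sol: "cauchy_solution \<alpha> \<epsilon> g u\<^sub>0 u" and \<epsilon>: "0 < \<epsilon>" and t: "0 < t"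
  shows "AE x in lebesgue. u\<^sub>0 x \<le> K \<Longrightarrow> u x t \<le> K + \<epsilon>"
    and "AE x in lebesgue. K \<le> u\<^sub>0 x \<Longrightarrow> K \<le> u x t"
proof -
  show "u x t \<le> K + \<epsilon>" if "AE x in lebesgue. u\<^sub>0 x \<le> K"
  proof -
    interpret periodic_fun_simple' g by unfold_locales (rule per)
    \<comment> \<open>The least number not below \<open>K\<close> of the form \<epsilon> times an
      integer translate of the zero \<open>z\<close>.\<close>
    define k where "k = \<epsilon> * (z + of_int \<lceil>K / \<epsilon> - z\<rceil>)"
    have "K / \<epsilon> \<le> k / \<epsilon>" "k / \<epsilon> \<le> K / \<epsilon> + 1"
      using \<epsilon> ceiling_correct[of "K / \<epsilon> - z"] le_of_int_ceiling[of "K / \<epsilon> - z"]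
      by (auto simp: k_def simp del: le_of_int_ceiling)
    then have k: "K \<le> k" "k \<le> K + \<epsilon>" using \<epsilon> by (auto simp: field_simps)
    have "g (k / \<epsilon>) = 0" using \<epsilon> zero by (simp add: k_def plus_of_int)
    moreover have "AE x in lebesgue. u\<^sub>0 x \<le> k"
      using that by eventually_elim (use k in simp)
    ultimately have "u x t \<le> k"
      using cauchy_solution_constant_comparison(1)[OF sol \<epsilon> lip t] by simp
    then show ?thesis using k by simp
  qed
  show "K \<le> u x t" if "AE x in lebesgue. K \<le> u\<^sub>0 x"
    using cauchy_solution_constant_comparison(2)[OF sol \<epsilon> lip t nonpos that] .
qed

section \<open>Common rate and passage to the limit\<close>

text \<open>The three cases are merged into one rate \<open>r\<close> that is uniform in the data,
  the solution, \<open>K\<close>, \<open>x\<close> and \<open>t\<close>. The last factor records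
  that the error grows linearly in time for \<open>p \<noteq> 0\<close> and is bounded in time for
  \<open>p = 0\<close>, where the barriers move with no error in the mean speed.\<close>

lemma homogenization_rate:
  fixes p :: "real ^ 'n"
  assumes \<alpha>: "\<alpha> < 1" and lip: "L-lipschitz_on UNIV g" and per: "\<And>v. g (v + 1) = g v" and nonpos: "\<And>v. g v \<le> 0"
  obtains r where "(r \<longlongrightarrow> 0) (at_right 0)" "\<forall>\<epsilon>>0. 0 \<le> r \<epsilon>"
    "\<forall>\<^sub>F \<epsilon> in at_right 0. \<forall>u\<^sub>0 u K x. \<forall>t>0. cauchy_solution \<alpha> \<epsilon> g u\<^sub>0 u \<longrightarrow>
       ((AE x in lebesgue. u\<^sub>0 x - p \<bullet> x \<le> K) \<longrightarrow>
          u x t \<le> p \<bullet> x + speed g p * t + K + r \<epsilon> * (1 + (if p = 0 then 0 else t))) \<and>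
       ((AE x in lebesgue. K \<le> u\<^sub>0 x - p \<bullet> x) \<longrightarrow>
          p \<bullet> x + speed g p * t + K - r \<epsilon> * (1 + (if p = 0 then 0 else t)) \<le> u x t)"
proof -
  have pos: "\<forall>\<^sub>F \<epsilon>::real in at_right 0. 0 < \<epsilon>" by (simp add: eventually_at_right_less)
  consider "p \<noteq> 0" | "p = 0" "\<And>s. g s < 0" | z where "p = 0" "g z = 0"
    using nonpos by (metis order_le_less)
  then show ?thesis
  proof cases
    case 1
    show ?thesis
    proof (rule oscillating_plane_wave_bounds[OF 1 lip per, where \<alpha>=\<alpha>])
      fix A B M
      assume AB: "0 \<le> A" "0 \<le> B"
        and le: "\<And>\<epsilon> u\<^sub>0 u K x t. 0 < \<epsilon> \<Longrightarrow> M * \<epsilon> powr (1 - \<alpha>) \<le> 1 / 2 \<Longrightarrow> cauchy_solution \<alpha> \<epsilon> g u\<^sub>0 u \<Longrightarrow> 0 < t \<Longrightarrow>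
         AE x in lebesgue. u\<^sub>0 x - p \<bullet> x \<le> K \<Longrightarrow>
         u x t \<le> p \<bullet> x + speed g p * t + K + (A * t + B * \<epsilon>) * \<epsilon> powr (1 - \<alpha>)"
        and ge: "\<And>\<epsilon> u\<^sub>0 u K x t. 0 < \<epsilon> \<Longrightarrow> M * \<epsilon> powr (1 - \<alpha>) \<le> 1 / 2 \<Longrightarrow> cauchy_solution \<alpha> \<epsilon> g u\<^sub>0 u \<Longrightarrow> 0 < t \<Longrightarrow>
         AE x in lebesgue. K \<le> u\<^sub>0 x - p \<bullet> x \<Longrightarrow>
         p \<bullet> x + speed g p * t + K - (A * t + B * \<epsilon>) * \<epsilon> powr (1 - \<alpha>) \<le> u x t"
      \<comment> \<open>Since
        \<open>A * t + B * \<epsilon> \<le> (A + B * \<epsilon>) * (1 + t)\<close>, the time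
        dependence can be split off as the factor \<open>1 + t\<close>.\<close>
      define r where "r \<epsilon> = (A + B * \<epsilon>) * \<epsilon> powr (1 - \<alpha>)" for \<epsilon>
      \<comment> \<open>Here \<open>\<alpha> < 1\<close> enters: the exponent is positive.\<close>
      have powr: "((\<lambda>\<epsilon>::real. \<epsilon> powr (1 - \<alpha>)) \<longlongrightarrow> 0) (at_right 0)"
      proof (rule tendsto_zero_powrI)
        show "\<forall>\<^sub>F \<epsilon>::real in at_right 0. 0 \<le> \<epsilon>" using pos by eventually_elim simp
      qed (use \<alpha> in \<open>auto intro!: tendsto_eq_intros\<close>)
      have rlim: "(r \<longlongrightarrow> 0) (at_right 0)"
      proof -
        have "((\<lambda>\<epsilon>. (A + B * \<epsilon>) * \<epsilon> powr (1 - \<alpha>)) \<longlongrightarrow> (A + B * 0) * 0) (at_right 0)"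
          by (intro tendsto_intros powr)
        then show ?thesis by (simp add: r_def[abs_def])
      qed
      have rle: "(A * t + B * \<epsilon>) * \<epsilon> powr (1 - \<alpha>) \<le> r \<epsilon> * (1 + t)" if "0 < t" "0 < \<epsilon>" for t \<epsilon>
      proof -
        have "A * t + B * \<epsilon> \<le> (A + B * \<epsilon>) * (1 + t)"
          using AB that by (simp add: algebra_simps)
        then have "(A * t + B * \<epsilon>) * \<epsilon> powr (1 - \<alpha>) \<le> (A + B * \<epsilon>) * (1 + t) * \<epsilon> powr (1 - \<alpha>)"
          by (rule mult_right_mono) simp
        then show ?thesis by (simp add: r_def mult_ac)
      qed
      have "((\<lambda>\<epsilon>::real. M * \<epsilon> powr (1 - \<alpha>)) \<longlongrightarrow> M * 0) (at_right 0)"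
        by (intro tendsto_intros powr)
      then have "\<forall>\<^sub>F \<epsilon> in at_right 0. M * \<epsilon> powr (1 - \<alpha>) < 1 / 2"
        by (rule order_tendstoD) simp
      then have "\<forall>\<^sub>F \<epsilon> in at_right 0. \<forall>u\<^sub>0 u K x. \<forall>t>0. cauchy_solution \<alpha> \<epsilon> g u\<^sub>0 u \<longrightarrow>
         ((AE x in lebesgue. u\<^sub>0 x - p \<bullet> x \<le> K) \<longrightarrow>
            u x t \<le> p \<bullet> x + speed g p * t + K + r \<epsilon> * (1 + t)) \<and>
         ((AE x in lebesgue. K \<le> u\<^sub>0 x - p \<bullet> x) \<longrightarrow>
            p \<bullet> x + speed g p * t + K - r \<epsilon> * (1 + t) \<le> u x t)"
        using pos
      proof eventually_elim
        case (elim \<epsilon>)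
        then have small: "M * \<epsilon> powr (1 - \<alpha>) \<le> 1 / 2" by simp
        show ?case
        proof (intro allI impI conjI)
          fix u\<^sub>0 :: "real ^ 'n \<Rightarrow> real" and u K x and t :: real
          assume t: "0 < t" and sol: "cauchy_solution \<alpha> \<epsilon> g u\<^sub>0 u"
          show "u x t \<le> p \<bullet> x + speed g p * t + K + r \<epsilon> * (1 + t)" if "AE x in lebesgue. u\<^sub>0 x - p \<bullet> x \<le> K"
            using le[OF elim(2) small sol t that, of x] rle[OF t elim(2)] by linarith
          show "p \<bullet> x + speed g p * t + K - r \<epsilon> * (1 + t) \<le> u x t" if "AE x in lebesgue. K \<le> u\<^sub>0 x - p \<bullet> x"
            using ge[OF elim(2) small sol t that, of x] rle[OF t elim(2)] by linarith
        qed
      qed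
      then show ?thesis
        by (intro that[of r] rlim) (use AB 1 in \<open>auto simp: r_def\<close>)
    qed
  next
    case 2
    show ?thesis
    proof (rule parabolic_flat_bounds_negative[OF 2(2) lip per, where \<alpha>=\<alpha> and 'n='n])
      fix B
      assume B: "0 \<le> B"
        and le: "\<And>\<epsilon> (u\<^sub>0 :: real ^ 'n \<Rightarrow> real) u K x t. 0 < \<epsilon> \<Longrightarrow> cauchy_solution \<alpha> \<epsilon> g u\<^sub>0 u \<Longrightarrow> 0 < t \<Longrightarrow>
         AE x in lebesgue. u\<^sub>0 x \<le> K \<Longrightarrow> u x t \<le> speed g (0 :: real ^ 'n) * t + K + B * \<epsilon>"
        and ge: "\<And>\<epsilon> (u\<^sub>0 :: real ^ 'n \<Rightarrow> real) u K x t. 0 < \<epsilon> \<Longrightarrow> cauchy_solution \<alpha> \<epsilon> g u\<^sub>0 u \<Longrightarrow> 0 < t \<Longrightarrow>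
         AE x in lebesgue. K \<le> u\<^sub>0 x \<Longrightarrow> speed g (0 :: real ^ 'n) * t + K - B * \<epsilon> \<le> u x t"
      show ?thesis
      proof (rule that[of "\<lambda>\<epsilon>. B * \<epsilon>"])
        show "((\<lambda>\<epsilon>. B * \<epsilon>) \<longlongrightarrow> 0) (at_right 0)" by (auto intro!: tendsto_eq_intros)
        show "\<forall>\<^sub>F \<epsilon> in at_right 0. \<forall>u\<^sub>0 u K x. \<forall>t>0. cauchy_solution \<alpha> \<epsilon> g u\<^sub>0 u \<longrightarrow>
         ((AE x in lebesgue. u\<^sub>0 x - p \<bullet> x \<le> K) \<longrightarrow>
            u x t \<le> p \<bullet> x + speed g p * t + K + (B * \<epsilon>) * (1 + (if p = 0 then 0 else t))) \<and>
         ((AE x in lebesgue. K \<le> u\<^sub>0 x - p \<bullet> x) \<longrightarrow>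
            p \<bullet> x + speed g p * t + K - (B * \<epsilon>) * (1 + (if p = 0 then 0 else t)) \<le> u x t)"
          using pos
        proof eventually_elim
          case (elim \<epsilon>)
          show ?case
          proof (intro allI impI conjI)
            fix u\<^sub>0 :: "real ^ 'n \<Rightarrow> real" and u K x and t :: real
            assume t: "0 < t" and sol: "cauchy_solution \<alpha> \<epsilon> g u\<^sub>0 u"
            show "u x t \<le> p \<bullet> x + speed g p * t + K + (B * \<epsilon>) * (1 + (if p = 0 then 0 else t))"
              if "AE x in lebesgue. u\<^sub>0 x - p \<bullet> x \<le> K"
              using le[OF elim sol t, of K x] that 2(1) by simp
            show "p \<bullet> x + speed g p * t + K - (B * \<epsilon>) * (1 + (if p = 0 then 0 else t)) \<le> u x t"
              if "AE x in lebesgue. K \<le> u\<^sub>0 x - p \<bullet> x"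
              using ge[OF elim sol t, of K x] that 2(1) by simp
          qed
        qed
      qed (use B in auto)
    qed
  next
    case 3
    have speed: "speed g p = 0" using 3 by (auto simp: speed_def) (metis less_irrefl)
    note b = parabolic_flat_bounds_vanishing[OF 3(2) nonpos lip per]
    show ?thesis
    proof (rule that[of "\<lambda>\<epsilon>. \<epsilon>"])
      show "((\<lambda>\<epsilon>::real. \<epsilon>) \<longlongrightarrow> 0) (at_right 0)" by (auto intro!: tendsto_eq_intros)
      show "\<forall>\<^sub>F \<epsilon> in at_right 0. \<forall>u\<^sub>0 u K x. \<forall>t>0. cauchy_solution \<alpha> \<epsilon> g u\<^sub>0 u \<longrightarrow>
       ((AE x in lebesgue. u\<^sub>0 x - p \<bullet> x \<le> K) \<longrightarrow>
          u x t \<le> p \<bullet> x + speed g p * t + K + \<epsilon> * (1 + (if p = 0 then 0 else t))) \<and>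
       ((AE x in lebesgue. K \<le> u\<^sub>0 x - p \<bullet> x) \<longrightarrow>
          p \<bullet> x + speed g p * t + K - \<epsilon> * (1 + (if p = 0 then 0 else t)) \<le> u x t)"
        using pos
      proof eventually_elim
        case (elim \<epsilon>)
        show ?case
        proof (intro allI impI conjI)
          fix u\<^sub>0 :: "real ^ 'n \<Rightarrow> real" and u K x and t :: real
          assume t: "0 < t" and sol: "cauchy_solution \<alpha> \<epsilon> g u\<^sub>0 u"
          show "u x t \<le> p \<bullet> x + speed g p * t + K + \<epsilon> * (1 + (if p = 0 then 0 else t))"
            if "AE x in lebesgue. u\<^sub>0 x - p \<bullet> x \<le> K"
            using b(1)[OF sol elim t, of K x] that 3(1) speed by simp
          show "p \<bullet> x + speed g p * t + K - \<epsilon> * (1 + (if p = 0 then 0 else t)) \<le> u x t"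
            if "AE x in lebesgue. K \<le> u\<^sub>0 x - p \<bullet> x"
            using b(2)[OF sol elim t, of K x] that 3(1) speed elim by simp
        qed
      qed
    qed auto
  qed
qed

text \<open>The barriers with \<open>K\<close> equal to the essential bounds close up as
  \<open>r \<epsilon>\<close> tends to 0. For constant \<open>v_0\<close> they are separated by
  \<open>2 * r \<epsilon>\<close> if \<open>p = 0\<close>, which gives uniformity over all times.
  For \<open>p \<noteq> 0\<close> the separation carries the factor \<open>1 + t\<close>, so uniform
  convergence is stated on each bounded time interval.\<close>

theorem theorem3p1:
  fixes \<alpha> :: real
    and g :: "real \<Rightarrow> real"
    and u\<^sub>0 :: "real ^ 'n \<Rightarrow> real"
    and u :: "real \<Rightarrow> real ^ 'n \<Rightarrow> real \<Rightarrow> real"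
    and p :: "real ^ 'n"
  assumes "0 \<le> \<alpha>" and "\<alpha> < 1"
    and "\<exists>L. L-lipschitz_on UNIV g"
    and "\<forall>v. g (v + 1) = g v"
    and "\<forall>v. g v \<le> 0"
    and "\<forall>\<epsilon>>0. cauchy_solution \<alpha> \<epsilon> g u\<^sub>0 (u \<epsilon>)"
    and "in_Linfty (\<lambda>x. u\<^sub>0 x - p \<bullet> x)"
  shows
    "(\<forall>x. \<forall>t>0.
        ereal (p \<bullet> x + speed g p * t) + ess_inf (\<lambda>y. u\<^sub>0 y - p \<bullet> y)
          \<le> Liminf (at_right 0) (\<lambda>\<epsilon>. ereal (u \<epsilon> x t)) \<and>
        Liminf (at_right 0) (\<lambda>\<epsilon>. ereal (u \<epsilon> x t))
          \<le> Limsup (at_right 0) (\<lambda>\<epsilon>. ereal (u \<epsilon> x t)) \<and>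
        Limsup (at_right 0) (\<lambda>\<epsilon>. ereal (u \<epsilon> x t))
          \<le> ereal (p \<bullet> x + speed g p * t) + ess_sup (\<lambda>y. u\<^sub>0 y - p \<bullet> y)) \<and>
     (\<forall>k. (\<forall>x. u\<^sub>0 x - p \<bullet> x = k) \<longrightarrow>
        (\<forall>T\<ge>0. uniform_limit (UNIV \<times> {0..T}) (\<lambda>\<epsilon> (x, t). u \<epsilon> x t)
           (\<lambda>(x, t). p \<bullet> x + speed g p * t + k) (at_right 0)) \<and>
        (p = 0 \<longrightarrow> uniform_limit (UNIV \<times> {0..}) (\<lambda>\<epsilon> (x, t). u \<epsilon> x t)
           (\<lambda>(x, t). p \<bullet> x + speed g p * t + k) (at_right 0)))"
proof -
  obtain L where L: "L-lipschitz_on UNIV g" using assms(3) by blast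
  obtain r where r: "(r \<longlongrightarrow> 0) (at_right 0)" and r0: "\<forall>\<epsilon>>0. 0 \<le> r \<epsilon>" and
    ev: "\<forall>\<^sub>F \<epsilon> in at_right 0. \<forall>u\<^sub>0 u K x. \<forall>t>0. cauchy_solution \<alpha> \<epsilon> g u\<^sub>0 u \<longrightarrow>
       ((AE x in lebesgue. u\<^sub>0 x - p \<bullet> x \<le> K) \<longrightarrow>
          u x t \<le> p \<bullet> x + speed g p * t + K + r \<epsilon> * (1 + (if p = 0 then 0 else t))) \<and>
       ((AE x in lebesgue. K \<le> u\<^sub>0 x - p \<bullet> x) \<longrightarrow>
          p \<bullet> x + speed g p * t + K - r \<epsilon> * (1 + (if p = 0 then 0 else t)) \<le> u x t)"
    by (rule homogenization_rate[OF assms(2) L assms(4,5)[rule_format], of p])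
  let ?v = "\<lambda>y. u\<^sub>0 y - p \<bullet> y"
  let ?\<tau> = "\<lambda>t. if p = 0 then 0 else t"
  have pos: "\<forall>\<^sub>F \<epsilon>::real in at_right 0. 0 < \<epsilon>" by (simp add: eventually_at_right_less)
  have upper: "\<forall>\<^sub>F \<epsilon> in at_right 0. \<forall>x. \<forall>t>0. u \<epsilon> x t \<le> p \<bullet> x + speed g p * t + K + r \<epsilon> * (1 + ?\<tau> t)"
    if "AE x in lebesgue. ?v x \<le> K" for K
    using ev pos by eventually_elim (use assms(6) that in blast)
  have lower: "\<forall>\<^sub>F \<epsilon> in at_right 0. \<forall>x. \<forall>t>0. p \<bullet> x + speed g p * t + K - r \<epsilon> * (1 + ?\<tau> t) \<le> u \<epsilon> x t"
    if "AE x in lebesgue. K \<le> ?v x" for K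
    using ev pos by eventually_elim (use assms(6) that in blast)
  have v: "?v \<in> borel_measurable lebesgue" and "\<exists>M. AE x in lebesgue. \<bar>?v x\<bar> \<le> M"
    using assms(7) by (auto simp: in_Linfty_def)
  then obtain M where M: "AE x in lebesgue. \<bar>?v x\<bar> \<le> M" by blast
  \<comment> \<open>Lebesgue measure is not zero, so a property that holds almost everywhere holds
    at some point; this bounds the essential supremum from below.\<close>
  have nontriv: "ae_filter (lebesgue :: (real^'n) measure) \<noteq> bot"
    by (simp add: ae_filter_eq_bot_iff)
  \<comment> \<open>The essential supremum has to be a real number to serve as the constant
    \<open>K\<close> in the bounds.\<close>
  have bounded_esssup: "\<exists>S. esssup lebesgue (\<lambda>x. ereal (f x)) = ereal S \<and> (AE x in lebesgue. f x \<le> S)"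
    if f: "f \<in> borel_measurable lebesgue" and b: "AE x in lebesgue. \<bar>f x\<bar> \<le> M" for f :: "real^'n \<Rightarrow> real"
  proof -
    have fm: "(\<lambda>x. ereal (f x)) \<in> borel_measurable lebesgue" using f by simp
    have "esssup lebesgue (\<lambda>x. ereal (f x)) \<le> ereal M"
      by (rule esssup_I[OF fm]) (use b in \<open>eventually_elim; simp add: abs_le_iff\<close>)
    moreover have "ereal (- M) \<le> esssup lebesgue (\<lambda>x. ereal (f x))"
    proof -
      have "AE x in lebesgue. \<bar>f x\<bar> \<le> M \<and> ereal (f x) \<le> esssup lebesgue (\<lambda>x. ereal (f x))"
        by (rule eventually_conj[OF b esssup_AE])
      then obtain x where x: "\<bar>f x\<bar> \<le> M" "ereal (f x) \<le> esssup lebesgue (\<lambda>x. ereal (f x))"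
        using eventually_happens'[OF nontriv] by blast
      have "ereal (- M) \<le> ereal (f x)" using x(1) by (simp add: abs_le_iff)
      then show ?thesis using x(2) by (rule order_trans)
    qed
    ultimately obtain S where S: "esssup lebesgue (\<lambda>x. ereal (f x)) = ereal S"
      by (cases "esssup lebesgue (\<lambda>x. ereal (f x))") auto
    moreover have "AE x in lebesgue. f x \<le> S"
      using esssup_AE[of "\<lambda>x. ereal (f x)" lebesgue] unfolding S by simp
    ultimately show ?thesis by blast
  qed
  obtain S where S: "ess_sup ?v = ereal S" "AE x in lebesgue. ?v x \<le> S"
    using bounded_esssup[OF v M] by (auto simp: ess_sup_def)
  \<comment> \<open>The essential infimum is minus the essential supremum of the negated
    function.\<close>
  obtain I where I: "ess_inf ?v = ereal I" "AE x in lebesgue. I \<le> ?v x"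
  proof -
    have "(\<lambda>x. - ?v x) \<in> borel_measurable lebesgue" by (rule borel_measurable_uminus[OF v])
    moreover have "AE x in lebesgue. \<bar>- ?v x\<bar> \<le> M" using M by (simp only: abs_minus_cancel)
    ultimately obtain S where S: "esssup lebesgue (\<lambda>x. ereal (- ?v x)) = ereal S" "AE x in lebesgue. - ?v x \<le> S"
      using bounded_esssup by blast
    have "ess_inf ?v = ereal (- S)" using S(1) by (simp only: ess_inf_def uminus_ereal.simps)
    moreover have "AE x in lebesgue. - S \<le> ?v x" using S(2) by eventually_elim linarith
    ultimately show ?thesis using that by blast
  qed
  have lims: "ereal (p \<bullet> x + speed g p * t) + ess_inf ?v \<le> Liminf (at_right 0) (\<lambda>\<epsilon>. ereal (u \<epsilon> x t)) \<and>
      Liminf (at_right 0) (\<lambda>\<epsilon>. ereal (u \<epsilon> x t)) \<le> Limsup (at_right 0) (\<lambda>\<epsilon>. ereal (u \<epsilon> x t)) \<and>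
      Limsup (at_right 0) (\<lambda>\<epsilon>. ereal (u \<epsilon> x t)) \<le> ereal (p \<bullet> x + speed g p * t) + ess_sup ?v"
    if t: "0 < t" for x t
  proof (intro conjI)
    show "Liminf (at_right 0) (\<lambda>\<epsilon>. ereal (u \<epsilon> x t)) \<le> Limsup (at_right 0) (\<lambda>\<epsilon>. ereal (u \<epsilon> x t))"
      by (rule Liminf_le_Limsup) simp
    let ?q = "p \<bullet> x + speed g p * t"
    have "((\<lambda>\<epsilon>. ?q + S + r \<epsilon> * (1 + ?\<tau> t)) \<longlongrightarrow> ?q + S + 0 * (1 + ?\<tau> t)) (at_right 0)"
      by (intro tendsto_intros r)
    then have "Limsup (at_right 0) (\<lambda>\<epsilon>. ereal (?q + S + r \<epsilon> * (1 + ?\<tau> t))) = ereal (?q + S)"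
      by (intro lim_imp_Limsup) auto
    moreover have "Limsup (at_right 0) (\<lambda>\<epsilon>. ereal (u \<epsilon> x t)) \<le> Limsup (at_right 0) (\<lambda>\<epsilon>. ereal (?q + S + r \<epsilon> * (1 + ?\<tau> t)))"
      by (rule Limsup_mono) (use upper[OF S(2)] in eventually_elim, use t in auto)
    ultimately show "Limsup (at_right 0) (\<lambda>\<epsilon>. ereal (u \<epsilon> x t)) \<le> ereal ?q + ess_sup ?v"
      by (simp add: S(1))
    have "((\<lambda>\<epsilon>. ?q + I - r \<epsilon> * (1 + ?\<tau> t)) \<longlongrightarrow> ?q + I - 0 * (1 + ?\<tau> t)) (at_right 0)"
      by (intro tendsto_intros r)
    then have "Liminf (at_right 0) (\<lambda>\<epsilon>. ereal (?q + I - r \<epsilon> * (1 + ?\<tau> t))) = ereal (?q + I)"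
      by (intro lim_imp_Liminf) auto
    moreover have "Liminf (at_right 0) (\<lambda>\<epsilon>. ereal (?q + I - r \<epsilon> * (1 + ?\<tau> t))) \<le> Liminf (at_right 0) (\<lambda>\<epsilon>. ereal (u \<epsilon> x t))"
      by (rule Liminf_mono) (use lower[OF I(2)] in eventually_elim, use t in auto)
    ultimately show "ereal ?q + ess_inf ?v \<le> Liminf (at_right 0) (\<lambda>\<epsilon>. ereal (u \<epsilon> x t))"
      by (simp add: I(1))
  qed
  \<comment> \<open>\<open>T\<close> bounds only the part of time that enters the error. This covers
    bounded intervals for any \<open>p\<close>, and with \<open>T = 0\<close> also the whole
    half-line when \<open>p = 0\<close>.\<close>
  have unif: "uniform_limit (UNIV \<times> J) (\<lambda>\<epsilon> (x, t). u \<epsilon> x t) (\<lambda>(x, t). p \<bullet> x + speed g p * t + k) (at_right 0)"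
    if k: "\<And>x. ?v x = k" and J: "\<And>t. t \<in> J \<Longrightarrow> 0 \<le> t \<and> ?\<tau> t \<le> T" and T: "0 \<le> T" for k T and J :: "real set"
  proof (rule uniform_limitI)
    fix e :: real assume e: "0 < e"
    have "((\<lambda>\<epsilon>. r \<epsilon> * (1 + T)) \<longlongrightarrow> 0 * (1 + T)) (at_right 0)" by (intro tendsto_intros r)
    then have "\<forall>\<^sub>F \<epsilon> in at_right 0. r \<epsilon> * (1 + T) < e" using e by (intro order_tendstoD) auto
    moreover have "\<forall>\<^sub>F \<epsilon> in at_right 0. \<forall>x. \<forall>t>0. u \<epsilon> x t \<le> p \<bullet> x + speed g p * t + k + r \<epsilon> * (1 + ?\<tau> t)"
      by (rule upper) (simp add: k)
    moreover have "\<forall>\<^sub>F \<epsilon> in at_right 0. \<forall>x. \<forall>t>0. p \<bullet> x + speed g p * t + k - r \<epsilon> * (1 + ?\<tau> t) \<le> u \<epsilon> x t"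
      by (rule lower) (simp add: k)
    ultimately show "\<forall>\<^sub>F \<epsilon> in at_right 0. \<forall>z\<in>UNIV \<times> J.
        dist (case z of (x, t) \<Rightarrow> u \<epsilon> x t) (case z of (x, t) \<Rightarrow> p \<bullet> x + speed g p * t + k) < e"
      using pos
    proof eventually_elim
      case (elim \<epsilon>)
      have "\<bar>u \<epsilon> x t - (p \<bullet> x + speed g p * t + k)\<bar> < e" if "t \<in> J" for x t
      \<comment> \<open>The barrier bounds concern positive times only; at time 0 the value is
        prescribed at every point and equals the limit exactly.\<close>
      proof (cases "t = 0")
        case True
        have "u \<epsilon> x 0 = u\<^sub>0 x" using assms(6) elim(4) by (auto simp: cauchy_solution_def)
        then show ?thesis using True e k[of x] by simp
      next
        case False
        then have t: "0 < t" using J[OF that] by auto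
        have "r \<epsilon> * (1 + ?\<tau> t) \<le> r \<epsilon> * (1 + T)"
          using J[OF that] r0[rule_format, OF elim(4)] by (intro mult_left_mono) auto
        moreover have "u \<epsilon> x t \<le> p \<bullet> x + speed g p * t + k + r \<epsilon> * (1 + ?\<tau> t)"
          "p \<bullet> x + speed g p * t + k - r \<epsilon> * (1 + ?\<tau> t) \<le> u \<epsilon> x t"
          using elim(2,3) t by blast+
        ultimately show ?thesis using elim(1) by linarith
      qed
      then show ?case by (auto simp: dist_real_def)
    qed
  qed
  have unif_bounded: "uniform_limit (UNIV \<times> {0..T}) (\<lambda>\<epsilon> (x, t). u \<epsilon> x t) (\<lambda>(x, t). p \<bullet> x + speed g p * t + k) (at_right 0)"
    if "\<forall>x. ?v x = k" "0 \<le> T" for k T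
    by (rule unif[of k "{0..T}" T]) (use that in auto)
  have unif_flat: "uniform_limit (UNIV \<times> {0..}) (\<lambda>\<epsilon> (x, t). u \<epsilon> x t) (\<lambda>(x, t). p \<bullet> x + speed g p * t + k) (at_right 0)"
    if "\<forall>x. ?v x = k" "p = 0" for k
    by (rule unif[of k "{0..}" 0]) (use that in auto)
  show ?thesis
    by (rule conjI; intro allI impI; (intro conjI impI allI)?)
      (use lims unif_bounded unif_flat in blast)+
qed

end
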